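(* Let $\mathcal X$ and $\mathcal Y$ be finite dimensional. Let $L=\|K\|$, let $\beta>0$ and $\tau,\sigma>0$ satisfy $\tau L_f+\sigma\tau L^2+\tau\beta L<1$, let $i\in\{1,2,3\}$, and let $(x^n,y^n)_{n\ge 0}$ be generated from $(x^0,y^0)\in\mathcal X\times\mathcal Y$, with $x^{-1}=x^0$, by $$y^{n+1}\approx_2^{\delta_{n+1}}\mathrm{prox}_{\sigma h^*}\big(y^n+\sigma K(2x^n-x^{n-1})\big),\qquad x^{n+1}\approx_i^{\varepsilon_{n+1}}\mathrm{prox}_{\tau g}\big(x^n-\tau(K^*y^{n+1}+\nabla f(x^n)+e^{n+1})\big),$$ for all $n\ge0$, where $\varepsilon_n,\delta_n\ge0$ and $e^n\in\mathcal X$ $(n\ge 1)$ are given errors. Define $$A_{N,1}=A_{N,3}=\sum_{n=1}^N\big(\tau\|e^n\|+\sqrt{2\tau\varepsilon_n}\big),\qquad A_{N,2}=\sum_{n=1}^N\tau\|e^n\|,$$ $$B_{N,1}=B_{N,2}=\sum_{n=1}^N(\tau\varepsilon_n+\tau\delta_n),\qquad B_{N,3}=\sum_{n=1}^N\tau\delta_n.$$ If the partial sums $A_{N,i}$ and $B_{N,i}$ converge as $N\to\infty$, then there exists a saddle point $(x^*,y^* )\in\mathcal X\times\mathcal Y$ of $\mathcal L$ such that $x^n\to x^*$ and $y^n\to y^*$.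
   Context: $\mathcal X,\mathcal Y$ are real Hilbert spaces and $\bar{\mathbb R}=\mathbb R\cup\{+\infty\}$. $K:\mathcal X\to\mathcal Y$ is a bounded linear operator; $f:\mathcal X\to\bar{\mathbb R}$ is proper, convex, lower semicontinuous and differentiable with $\|\nabla f(x)-\nabla f(x')\|\le L_f\|x-x'\|$ for all $x,x'\in\mathrm{dom} f$; $g:\mathcal X\to\bar{\mathbb R}$ and $h:\mathcal Y\to\bar{\mathbb R}$ are proper, convex, lower semicontinuous; $h^*$ is the convex conjugate of $h$. Put $$\mathcal L(x,y)=\langle Kx,y\rangle+f(x)+g(x)-h^*(y).$$ A saddle point is a pair $(x^\star,y^\star)$ with $\mathcal L(x^\star,y)\le\mathcal L(x^\star,y^\star)\le\mathcal L(x,y^\star)$ for all $(x,y)\in\mathcal X\times\mathcal Y$; at least one is assumed to exist. Inexact proximal points. For a proper, convex, lower semicontinuous $\varphi:\mathcal H\to\bar{\mathbb R}$ on a Hilbert space $\mathcal H$, $\lambda>0$ and $v\in\mathcal H$, let $\mathrm{prox}_{\lambda\varphi}(v)=\arg\min_{u}\{\frac1{2\lambda}\|u-v\|^2+\varphi(u)\}$ and $\Phi_\lambda(u)=\frac1{2\lambda}\|u-v\|^2+\varphi(u)$. For $\varepsilon\ge0$, $\partial_\varepsilon\varphi(z)=\{p:\varphi(u)\ge\varphi(z)+\langle p,u-z\rangle-\varepsilon\ \forall u\}$. Then - $z\approx_1^{\varepsilon}\mathrm{prox}_{\lambda\varphi}(v)$ means $0\in\partial_\varepsilon\Phi_\lambda(z)$;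 - $z\approx_2^{\varepsilon}\mathrm{prox}_{\lambda\varphi}(v)$ means $(v-z)/\lambda\in\partial_\varepsilon\varphi(z)$; - $z\approx_3^{\varepsilon}\mathrm{prox}_{\lambda\varphi}(v)$ means there is $r\in\mathcal H$ with $\|r\|\le\sqrt{2\lambda\varepsilon}$ and $z=\mathrm{prox}_{\lambda\varphi}(v+r)$. *)

theory Defs
  imports "HOL-Analysis.Analysis"
begin

text \<open>Functions with values in the reals extended by plus infinity are functions into
  \<^typ>\<open>ereal\<close>; the value minus infinity is excluded by properness.\<close>

definition edom :: "('a \<Rightarrow> ereal) \<Rightarrow> 'a set" where
  "edom f = {x. f x < \<infinity>}"

definition proper :: "('a \<Rightarrow> ereal) \<Rightarrow> bool" where
  "proper f \<longleftrightarrow> (\<forall>x. f x \<noteq> -\<infinity>) \<and> (\<exists>x. f x \<noteq> \<infinity>)"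

text \<open>In \<^typ>\<open>ereal\<close> the product of zero and infinity is zero, so the cases
  \<open>t = 0\<close> and \<open>t = 1\<close> hold trivially.\<close>

definition econvex :: "('a::real_vector \<Rightarrow> ereal) \<Rightarrow> bool" where
  "econvex f \<longleftrightarrow> (\<forall>x y. \<forall>t\<in>{0..1::real}.
     f ((1 - t) *\<^sub>R x + t *\<^sub>R y) \<le> ereal (1 - t) * f x + ereal t * f y)"

definition lsc :: "('a::topological_space \<Rightarrow> ereal) \<Rightarrow> bool" where
  "lsc f \<longleftrightarrow> (\<forall>x. f x \<le> Liminf (at x) f)"

text \<open>Differentiability of an extended-valued function at a point means that it is finite
  near that point and that its real-valued restriction has a Frechet derivative there. The
  interior condition is needed because \<^const>\<open>real_of_ereal\<close> sends infinity to zero.\<close>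

definition has_egradient :: "('a::real_inner \<Rightarrow> ereal) \<Rightarrow> 'a \<Rightarrow> 'a \<Rightarrow> bool" where
  "has_egradient f x d \<longleftrightarrow> x \<in> interior (edom f) \<and> GDERIV (\<lambda>u. real_of_ereal (f u)) x :> d"

definition conjugate :: "('a::real_inner \<Rightarrow> ereal) \<Rightarrow> 'a \<Rightarrow> ereal" where
  "conjugate h y = (SUP u. ereal (u \<bullet> y) - h u)"

text \<open>In \<^typ>\<open>ereal\<close>, infinity minus infinity is infinity: where \<open>f x + g x\<close> and the
  conjugate of \<open>h\<close> at \<open>y\<close> are both infinite, the Lagrangian has the value infinity.\<close>

definition lagrangian :: "('a::real_inner \<Rightarrow> 'b::real_inner) \<Rightarrow> ('a \<Rightarrow> ereal) \<Rightarrow> ('a \<Rightarrow> ereal)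
    \<Rightarrow> ('b \<Rightarrow> ereal) \<Rightarrow> 'a \<Rightarrow> 'b \<Rightarrow> ereal" where
  "lagrangian K f g h x y = ereal (K x \<bullet> y) + f x + g x - conjugate h y"

definition saddle_point :: "('a \<Rightarrow> 'b \<Rightarrow> ereal) \<Rightarrow> 'a \<Rightarrow> 'b \<Rightarrow> bool" where
  "saddle_point L xs ys \<longleftrightarrow> (\<forall>x y. L xs y \<le> L xs ys \<and> L xs ys \<le> L x ys)"

definition eps_subdiff :: "real \<Rightarrow> ('a::real_inner \<Rightarrow> ereal) \<Rightarrow> 'a \<Rightarrow> 'a set" where
  "eps_subdiff eps \<phi> z = {p. \<forall>u. \<phi> u \<ge> \<phi> z + ereal (p \<bullet> (u - z)) - ereal eps}"

definition prox_objective :: "real \<Rightarrow> ('a::real_inner \<Rightarrow> ereal) \<Rightarrow> 'a \<Rightarrow> 'a \<Rightarrow> ereal" where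
  "prox_objective lam \<phi> v u = ereal (1 / (2 * lam) * (norm (u - v))\<^sup>2) + \<phi> u"

definition prox :: "real \<Rightarrow> ('a::real_inner \<Rightarrow> ereal) \<Rightarrow> 'a \<Rightarrow> 'a" where
  "prox lam \<phi> v = (ARG_MIN (prox_objective lam \<phi> v) u. True)"

text \<open>\<open>inexact_prox i eps lam \<phi> v z\<close>: the point \<open>z\<close> is a type-\<open>i\<close> approximation, with
  precision \<open>eps\<close>, of \<open>prox lam \<phi> v\<close>; there are three types.\<close>

definition inexact_prox ::
    "nat \<Rightarrow> real \<Rightarrow> real \<Rightarrow> ('a::real_inner \<Rightarrow> ereal) \<Rightarrow> 'a \<Rightarrow> 'a \<Rightarrow> bool" where
  "inexact_prox i eps lam \<phi> v z \<longleftrightarrow>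
     (i = 1 \<and> 0 \<in> eps_subdiff eps (prox_objective lam \<phi> v) z) \<or>
     (i = 2 \<and> (1 / lam) *\<^sub>R (v - z) \<in> eps_subdiff eps \<phi> z) \<or>
     (i = 3 \<and> (\<exists>r. norm r \<le> sqrt (2 * lam * eps) \<and> z = prox lam \<phi> (v + r)))"

definition err_A :: "nat \<Rightarrow> real \<Rightarrow> (nat \<Rightarrow> 'a::real_normed_vector) \<Rightarrow> (nat \<Rightarrow> real) \<Rightarrow> nat \<Rightarrow> real" where
  "err_A i \<tau> e \<epsilon> N =
     (if i = 2 then \<Sum>n=1..N. \<tau> * norm (e n)
      else \<Sum>n=1..N. \<tau> * norm (e n) + sqrt (2 * \<tau> * \<epsilon> n))"

definition err_B :: "nat \<Rightarrow> real \<Rightarrow> (nat \<Rightarrow> real) \<Rightarrow> (nat \<Rightarrow> real) \<Rightarrow> nat \<Rightarrow> real" where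
  "err_B i \<tau> \<epsilon> \<delta> N =
     (if i = 3 then \<Sum>n=1..N. \<tau> * \<delta> n
      else \<Sum>n=1..N. \<tau> * \<epsilon> n + \<tau> * \<delta> n)"

end

theory Submission
  imports Defs
begin

text \<open>All three types of approximation reduce to type 2, the perturbation of the prox argument being
  absorbed into \<open>e\<close>. For a saddle point \<open>(u, w)\<close> and a constant \<open>c\<close> strictly between
  \<open>\<sigma> \<parallel>K\<parallel>\<^sup>2\<close> and \<open>1 / \<tau> - L\<^sub>f\<close>, the energy
  \<open>\<parallel>u - x n\<parallel>\<^sup>2 / (2\<tau>) + \<parallel>w - y n\<parallel>\<^sup>2 / (2\<sigma>) + \<langle>K (x n - x (n - 1)), y n - w\<rangle>
  + c / 2 * \<parallel>x n - x (n - 1)\<parallel>\<^sup>2\<close> controls the distance to \<open>(u, w)\<close> and decreases up to summable errors.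
  Hence it converges and the increments of the iterates tend to zero. By lower semicontinuity a
  cluster point is a saddle point; the energy relative to it tends to zero along a subsequence,
  hence along the whole sequence.\<close>

subsection \<open>Finite-dimensional inner product spaces\<close>

text \<open>Both sides are linear in \<open>x\<close>, so generators suffice, and for
  \<open>x = b\<close> in \<open>C\<close> orthogonality leaves only the term \<open>c = b\<close>.
  A zero vector in \<open>C\<close> is harmless because its term vanishes.\<close>

lemma orthogonal_expansion:
  fixes C :: "'a::real_inner set"
  assumes "finite C" "pairwise orthogonal C" "x \<in> span C"
  shows "(\<Sum>c\<in>C. (x \<bullet> c / (c \<bullet> c)) *\<^sub>R c) = x"
  using assms(3)
proof (induction rule: span_induct_alt)
  case base
  then show ?case by simp
next
  case (step a b y)
  have "(\<Sum>c\<in>C. (b \<bullet> c / (c \<bullet> c)) *\<^sub>R c) = (\<Sum>c\<in>C. if c = b then b else 0)"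
    using assms(2) step.hyps
    by (intro sum.cong) (auto simp: pairwise_def orthogonal_def)
  also have "\<dots> = b"
    using assms(1) step.hyps by simp
  finally have "(\<Sum>c\<in>C. (b \<bullet> c / (c \<bullet> c)) *\<^sub>R c) = b" .
  moreover have "(\<Sum>c\<in>C. ((a *\<^sub>R b + y) \<bullet> c / (c \<bullet> c)) *\<^sub>R c) =
      a *\<^sub>R (\<Sum>c\<in>C. (b \<bullet> c / (c \<bullet> c)) *\<^sub>R c) + (\<Sum>c\<in>C. (y \<bullet> c / (c \<bullet> c)) *\<^sub>R c)"
    by (simp add: scaleR_sum_right sum.distrib[symmetric] inner_add_left add_divide_distrib
        scaleR_add_left)
  ultimately show ?case using step.IH by simp
qed

text \<open>Gram-Schmidt applied to the spanning set. The expansion provides the coordinates behind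
  both the compactness of balls and the adjoint.\<close>

lemma finite_span_orthogonal:
  assumes "\<exists>B :: 'a::real_inner set. finite B \<and> span B = UNIV"
  obtains C :: "'a::real_inner set" where "finite C"
    "\<And>x. (\<Sum>c\<in>C. (x \<bullet> c / (c \<bullet> c)) *\<^sub>R c) = x"
proof -
  from assms obtain B :: "'a set" where "finite B" "span B = UNIV" by blast
  moreover from this obtain C where "finite C" "span C = span B" "pairwise orthogonal C"
    using basis_orthogonal by blast
  ultimately show ?thesis using that orthogonal_expansion[of C] by simp
qed

text \<open>A compact superset is enough, since a closed ball will be a closed subset of it. Each
  new generator \<open>b\<close> contributes a factor interval, followed by a continuous
  map.\<close>

lemma compact_superset_combinations:
  fixes C :: "'a::real_normed_vector set"
  assumes "finite C"
  shows "\<exists>S. compact S \<and> (\<forall>a. (\<forall>c\<in>C. \<bar>a c\<bar> \<le> M c) \<longrightarrow> (\<Sum>c\<in>C. a c *\<^sub>R c) \<in> S)"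
  using assms
proof (induction rule: finite_induct)
  case empty
  show ?case by (rule exI[of _ "{0}"]) simp
next
  case (insert b C)
  then obtain S where S: "compact S" "\<And>a. (\<forall>c\<in>C. \<bar>a c\<bar> \<le> M c) \<Longrightarrow> (\<Sum>c\<in>C. a c *\<^sub>R c) \<in> S"
    by blast
  let ?T = "(\<lambda>(t, s). t *\<^sub>R b + s) ` ({- M b..M b} \<times> S)"
  have "compact ?T"
    by (intro compact_continuous_image compact_Times S compact_Icc)
      (auto intro!: continuous_intros simp: case_prod_unfold)
  moreover have "(\<Sum>c\<in>insert b C. a c *\<^sub>R c) \<in> ?T" if "\<forall>c\<in>insert b C. \<bar>a c\<bar> \<le> M c" for a
    using insert.hyps that S(2)[of a]
    by (auto intro!: image_eqI[of _ _ "(a b, \<Sum>c\<in>C. a c *\<^sub>R c)"] simp: abs_le_iff)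
  ultimately show ?case by blast
qed

lemma finite_span_compact_cball:
  fixes z :: "'a::real_inner"
  assumes "\<exists>B :: 'a set. finite B \<and> span B = UNIV"
  shows "compact (cball z r)"
proof -
  obtain C :: "'a set" where C: "finite C" "\<And>x. (\<Sum>c\<in>C. (x \<bullet> c / (c \<bullet> c)) *\<^sub>R c) = x"
    using finite_span_orthogonal[OF assms] by blast
  \<comment> \<open>Cauchy-Schwarz with \<open>norm x \<le> norm z + r\<close> on the ball bounds
    the coefficient of \<open>c\<close> by \<open>M c\<close>.\<close>
  define M where "M c = (norm z + r) * norm c / (c \<bullet> c)" for c :: 'a
  obtain S where S: "compact S" "\<And>a. (\<forall>c\<in>C. \<bar>a c\<bar> \<le> M c) \<Longrightarrow> (\<Sum>c\<in>C. a c *\<^sub>R c) \<in> S"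
    using compact_superset_combinations[OF C(1), of M] by blast
  have "x \<in> S" if "x \<in> cball z r" for x
  proof -
    have "norm x \<le> norm z + r"
      using that norm_triangle_ineq2[of x z] by (simp add: dist_norm norm_minus_commute)
    then have "\<bar>x \<bullet> c\<bar> \<le> (norm z + r) * norm c" for c
      using Cauchy_Schwarz_ineq2[of x c] by (meson mult_right_mono norm_ge_zero order_trans)
    then have "\<forall>c\<in>C. \<bar>x \<bullet> c / (c \<bullet> c)\<bar> \<le> M c"
      by (auto simp: M_def abs_divide intro!: divide_right_mono)
    from S(2)[OF this] show ?thesis by (simp add: C(2))
  qed
  then have "cball z r \<subseteq> S" by blast
  then show ?thesis
    using compact_Int_closed[OF S(1) closed_cball] by (metis Int_absorb1)
qed

text \<open>\<open>adjoint\<close> is defined by choice, so the identity follows once some map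
  satisfies it for all arguments; expanding \<open>u\<close> in an orthogonal spanning set produces
  such a map.\<close>

lemma finite_span_adjoint:
  fixes K :: "'a::real_inner \<Rightarrow> 'b::real_inner"
  assumes "\<exists>B :: 'a set. finite B \<and> span B = UNIV" and "linear K"
  shows "K u \<bullet> w = u \<bullet> adjoint K w"
proof -
  obtain C :: "'a set" where C: "finite C" "\<And>x. (\<Sum>c\<in>C. (x \<bullet> c / (c \<bullet> c)) *\<^sub>R c) = x"
    using finite_span_orthogonal[OF assms(1)] by blast
  have K': "K u \<bullet> w = u \<bullet> (\<Sum>c\<in>C. (K c \<bullet> w / (c \<bullet> c)) *\<^sub>R c)" for u w
  proof -
    have "K u = K (\<Sum>c\<in>C. (u \<bullet> c / (c \<bullet> c)) *\<^sub>R c)"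
      by (simp only: C(2))
    also have "\<dots> = (\<Sum>c\<in>C. (u \<bullet> c / (c \<bullet> c)) *\<^sub>R K c)"
      by (simp add: linear_sum[OF assms(2)] linear_scale[OF assms(2)])
    finally have "K u \<bullet> w = (\<Sum>c\<in>C. (u \<bullet> c / (c \<bullet> c)) * (K c \<bullet> w))"
      by (simp only: inner_sum_left inner_scaleR_left)
    also have "\<dots> = u \<bullet> (\<Sum>c\<in>C. (K c \<bullet> w / (c \<bullet> c)) *\<^sub>R c)"
      unfolding inner_sum_right inner_scaleR_right by (intro sum.cong refl) simp
    finally show ?thesis .
  qed
  have "\<exists>K'. \<forall>u w. K u \<bullet> w = u \<bullet> K' w"
    by (rule exI[of _ "\<lambda>w. \<Sum>c\<in>C. (K c \<bullet> w / (c \<bullet> c)) *\<^sub>R c"], intro allI, rule K')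
  from someI_ex[OF this] show ?thesis unfolding adjoint_def by blast
qed

lemma bounded_subseq_convergent:
  fixes X :: "nat \<Rightarrow> 'a::real_normed_vector"
  assumes "compact (cball 0 B :: 'a set)" "\<And>n. norm (X n) \<le> B"
  obtains l r where "strict_mono r" "(X \<circ> r) \<longlonglongrightarrow> l"
proof -
  have "seq_compact (cball 0 B :: 'a set)"
    using assms(1) by (rule compact_imp_seq_compact)
  moreover have "\<forall>n. X n \<in> cball 0 B" using assms(2) by simp
  ultimately show ?thesis using that unfolding seq_compact_def by blast
qed

subsection \<open>The energy inequality\<close>

text \<open>A bound on \<open>V\<close> must come first: with \<open>M\<close> the maximum of \<open>sqrt V\<close> on an initial segment,
  \<open>M\<^sup>2 \<le> V 0 + A * M + B\<close> where \<open>A\<close>, \<open>B\<close> are the sums of the two error sequences.\<close>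

lemma quasi_Fejer:
  fixes V D a b :: "nat \<Rightarrow> real"
  assumes V: "\<And>n. V n \<ge> 0" and D: "\<And>n. D n \<ge> 0"
    and a: "\<And>n. a n \<ge> 0" "summable a" and b: "\<And>n. b n \<ge> 0" "summable b"
    and step: "\<And>n. V (Suc n) + D n \<le> V n + a n * sqrt (V (Suc n)) + b n"
  shows "convergent V" "D \<longlonglongrightarrow> 0" "\<exists>M. \<forall>n. V n \<le> M"
proof -
  have rec: "V n \<le> V 0 + M * sum a {..<n} + sum b {..<n}"
    if "\<And>k. k \<le> n \<Longrightarrow> sqrt (V k) \<le> M" for n M
    using that
  proof (induction n)
    case (Suc n)
    have "a n * sqrt (V (Suc n)) \<le> a n * M"
      using Suc.prems a(1) by (intro mult_left_mono) auto
    with Suc step[of n] D[of n] show ?case by (simp add: algebra_simps)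
  qed simp
  define A B where "A = suminf a" and "B = suminf b"
  have AB: "sum a {..<n} \<le> A" "sum b {..<n} \<le> B" for n
    unfolding A_def B_def using a b by (auto intro: sum_le_suminf)
  have A0: "A \<ge> 0" "B \<ge> 0" using AB[of 0] by auto
  have bd: "sqrt (V n) \<le> 1 + V 0 + A + B" for n
  proof -
    define M where "M = Max ((\<lambda>k. sqrt (V k)) ` {..n})"
    have M: "sqrt (V k) \<le> M" if "k \<le> n" for k
      unfolding M_def using that by (intro Max_ge) auto
    have M0: "0 \<le> M" using M[of n] V[of n] by (meson order_trans order_refl real_sqrt_ge_zero)
    have "M \<in> (\<lambda>k. sqrt (V k)) ` {..n}" unfolding M_def by (intro Max_in) auto
    then obtain k where k: "k \<le> n" "M = sqrt (V k)" by auto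
    have "V k \<le> V 0 + M * sum a {..<k} + sum b {..<k}"
      using M k by (intro rec) auto
    also have "\<dots> \<le> V 0 + M * A + B"
      using AB M0 by (intro add_mono mult_left_mono) auto
    finally have *: "M * M \<le> V 0 + M * A + B" using k V[of k] by simp
    have "M \<le> 1 + V 0 + A + B"
    \<comment> \<open>For \<open>M > 1\<close> the constant \<open>V 0 + B\<close> is at most
      \<open>M\<close> times itself, so the quadratic inequality can be divided by
      \<open>M\<close>.\<close>
    proof (cases "M \<le> 1")
      case True
      then show ?thesis using A0 V[of 0] by linarith
    next
      case False
      then have "V 0 + B \<le> M * (V 0 + B)"
        using A0 V[of 0] mult_right_mono[of 1 M "V 0 + B"] by simp
      with * have "M * M \<le> M * (V 0 + A + B)" by (simp add: algebra_simps)
      then have "M \<le> V 0 + A + B" using False by simp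
      then show ?thesis by simp
    qed
    with M[of n] show ?thesis by simp
  qed
  define M where "M = 1 + V 0 + A + B"
  have "V n \<le> M\<^sup>2" for n
    using power_mono[OF bd[of n], of 2] V[of n] by (simp add: M_def)
  then show "\<exists>M. \<forall>n. V n \<le> M" by blast
  define c where "c n = a n * M + b n" for n
  have c: "summable c" "\<And>n. c n \<ge> 0"
    unfolding c_def using a b A0 V[of 0]
    by (auto intro!: summable_add summable_mult2 simp: M_def)
  \<comment> \<open>With \<open>sqrt V\<close> bounded, the errors in each step are at most the
    summable \<open>c n\<close>. Subtracting those accumulated so far makes the sequence decreasing,
    and its decrements dominate \<open>D\<close>.\<close>
  define W where "W n = V n - sum c {..<n}" for n
  have W: "W (Suc n) + D n \<le> W n" for n
    using step[of n] mult_left_mono[OF bd[of "Suc n"] a(1)[of n]]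
    by (simp add: W_def c_def M_def)
  have "W (Suc n) \<le> W n" for n using W[of n] D[of n] by linarith
  then have "decseq W" by (rule decseq_SucI)
  moreover have "W n \<ge> - suminf c" for n
    using V[of n] sum_le_suminf[OF c(1), of "{..<n}"] c(2) by (simp add: W_def)
  ultimately obtain w where w: "W \<longlonglongrightarrow> w"
    using decseq_convergent by metis
  have "(\<lambda>n. W n + sum c {..<n}) \<longlonglongrightarrow> w + suminf c"
    by (intro tendsto_add w summable_LIMSEQ c)
  then show "convergent V" by (auto simp: W_def convergent_def)
  have "(\<lambda>n. W n - W (Suc n)) \<longlonglongrightarrow> w - w"
    by (intro tendsto_diff w LIMSEQ_Suc)
  then show "D \<longlonglongrightarrow> 0"
    by (intro tendsto_sandwich[OF _ _ tendsto_const, of 0 D _ "\<lambda>n. W n - W (Suc n)"])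
      (use D W in \<open>auto intro!: always_eventually simp: le_diff_eq add.commute\<close>)
qed

text \<open>Cauchy-Schwarz, then Young's inequality as the nonnegativity of a square. The weight
  \<open>c\<close> decides how the coupling is split between the primal and the dual quadratic
  terms.\<close>

lemma Young_inner:
  fixes K :: "'a::real_normed_vector \<Rightarrow> 'b::real_inner"
  assumes K: "bounded_linear K" and c: "c > 0"
  shows "\<bar>K p \<bullet> q\<bar> \<le> c / 2 * (norm p)\<^sup>2 + (onorm K)\<^sup>2 / (2 * c) * (norm q)\<^sup>2"
proof -
  have "\<bar>K p \<bullet> q\<bar> \<le> norm (K p) * norm q" by (rule Cauchy_Schwarz_ineq2)
  also have "\<dots> \<le> onorm K * norm p * norm q"
    by (intro mult_right_mono onorm[OF K]) simp
  also have "\<dots> \<le> c / 2 * (norm p)\<^sup>2 + (onorm K)\<^sup>2 / (2 * c) * (norm q)\<^sup>2"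
  proof -
    have "0 \<le> (c * norm p - onorm K * norm q)\<^sup>2 / (2 * c)" using c by simp
    also have "\<dots> = c / 2 * (norm p)\<^sup>2 + (onorm K)\<^sup>2 / (2 * c) * (norm q)\<^sup>2
        - onorm K * norm p * norm q"
      using c by (simp add: power2_eq_square field_simps)
    finally show ?thesis by simp
  qed
  finally show ?thesis .
qed

text \<open>\<open>(p, q)\<close> is the current iterate, \<open>p'\<close> the previous primal one
  and \<open>(u, w)\<close> the reference point. The last summand is what Young's inequality charges
  to the primal increment when the indefinite coupling term is estimated.\<close>

definition energy :: "('a::real_inner \<Rightarrow> 'b::real_inner) \<Rightarrow> real \<Rightarrow> real \<Rightarrow> real \<Rightarrow>
    'a \<Rightarrow> 'b \<Rightarrow> 'a \<Rightarrow> 'b \<Rightarrow> 'a \<Rightarrow> real" where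
  "energy K \<tau> \<sigma> c u w p q p' =
     (norm (u - p))\<^sup>2 / (2 * \<tau>) + (norm (w - q))\<^sup>2 / (2 * \<sigma>)
     + K (p - p') \<bullet> (q - w) + c / 2 * (norm (p - p'))\<^sup>2"

text \<open>The last summand of the energy pays the primal share of the coupling term; the dual
  share reduces the coefficient of \<open>(norm (w - q))\<^sup>2\<close>, which for positive
  \<open>\<sigma>\<close> and \<open>c\<close> stays positive exactly when
  \<open>\<sigma> * (onorm K)\<^sup>2 < c\<close>.\<close>

lemma energy_ge:
  assumes K: "bounded_linear K" and "c > 0"
  shows "(norm (u - p))\<^sup>2 / (2 * \<tau>) + (1 / (2 * \<sigma>) - (onorm K)\<^sup>2 / (2 * c)) * (norm (w - q))\<^sup>2
     \<le> energy K \<tau> \<sigma> c u w p q p'"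
  using Young_inner[OF assms, of "p - p'" "q - w"]
  by (simp add: energy_def norm_minus_commute[of w q] algebra_simps)

lemma polarization:
  fixes p :: "'a::real_inner"
  shows "(p - p1) \<bullet> (u - p1) = ((norm (p1 - p))\<^sup>2 + (norm (u - p1))\<^sup>2 - (norm (u - p))\<^sup>2) / 2"
  by (simp add: power2_norm_eq_inner algebra_simps inner_commute)

text \<open>The sum of all hypotheses: \<open>hy\<close> and \<open>hx\<close> are the subgradient
  inequalities of the two updates tested at \<open>w\<close> and \<open>u\<close>, \<open>hF\<close>
  treats the smooth part, and \<open>gap\<close> is the saddle property of \<open>(u, w)\<close> at
  the new iterate. Polarization turns the inner products into differences of squares.\<close>

lemma energy_step:
  fixes K :: "'a::real_inner \<Rightarrow> 'b::real_inner"
  assumes K: "bounded_linear K" and K': "\<And>u w. K u \<bullet> w = u \<bullet> K' w"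
    and pos: "\<tau> > 0" "\<sigma> > 0" "c > 0"
    and hy: "H1 + ((1 / \<sigma>) *\<^sub>R (q + \<sigma> *\<^sub>R K (2 *\<^sub>R p - p') - q1)) \<bullet> (w - q1) - \<delta> \<le> Hw"
    and hx: "G1 + ((1 / \<tau>) *\<^sub>R (p - \<tau> *\<^sub>R (K' q1 + d + e) - p1)) \<bullet> (u - p1) - \<epsilon> \<le> Gu"
    and hF: "F1 \<le> Fu + d \<bullet> (p1 - u) + l / 2 * (norm (p1 - p))\<^sup>2"
    and gap: "K u \<bullet> w + Fu + Gu \<le> K p1 \<bullet> w + F1 + G1" "Hw + K u \<bullet> (q1 - w) \<le> H1"
  shows "energy K \<tau> \<sigma> c u w p1 q1 p + ((1 / \<tau> - l - c) / 2 * (norm (p1 - p))\<^sup>2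
      + (1 / (2 * \<sigma>) - (onorm K)\<^sup>2 / (2 * c)) * (norm (q1 - q))\<^sup>2)
    \<le> energy K \<tau> \<sigma> c u w p q p' + norm e * norm (u - p1) + (\<epsilon> + \<delta>)"
proof -
  interpret K: bounded_linear K by fact
  have y: "((1 / \<sigma>) *\<^sub>R (q + \<sigma> *\<^sub>R K (2 *\<^sub>R p - p') - q1)) \<bullet> (w - q1)
      = 1 / \<sigma> * ((q - q1) \<bullet> (w - q1)) + K (2 *\<^sub>R p - p') \<bullet> (w - q1)"
    using pos by (simp add: inner_diff_left inner_add_left field_simps)
  have x: "((1 / \<tau>) *\<^sub>R (p - \<tau> *\<^sub>R (K' q1 + d + e) - p1)) \<bullet> (u - p1)
      = 1 / \<tau> * ((p - p1) \<bullet> (u - p1)) - K (u - p1) \<bullet> q1 - d \<bullet> (u - p1) - e \<bullet> (u - p1)"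
    using pos unfolding K' inner_commute[of "u - p1" "K' q1"]
    by (simp add: inner_diff_left inner_add_left right_diff_distrib distrib_left)
  \<comment> \<open>Thanks to the extrapolation \<open>2 p - p'\<close>, the bilinear terms are the
    new coupling term minus the old one, up to a product of two increments. \<open>Yo\<close>
    charges that product to the last summand of the old energy and to the dual increment.\<close>
  have Kterms: "K (2 *\<^sub>R p - p') \<bullet> (w - q1) - K (u - p1) \<bullet> q1 + K u \<bullet> q1 - K p1 \<bullet> w
      = K (p1 - p) \<bullet> (q1 - w) - K (p - p') \<bullet> (q - w) - K (p - p') \<bullet> (q1 - q)"
    by (simp add: K.diff K.scaleR inner_diff_left inner_diff_right)
  have e: "e \<bullet> (u - p1) \<le> norm e * norm (u - p1)"
    by (rule norm_cauchy_schwarz)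
  have Yo: "K (p - p') \<bullet> (q1 - q)
      \<le> c / 2 * (norm (p - p'))\<^sup>2 + (onorm K)\<^sup>2 / (2 * c) * (norm (q1 - q))\<^sup>2"
    using Young_inner[OF K pos(3), of "p - p'" "q1 - q"] by linarith
  have g: "K u \<bullet> (q1 - w) = K u \<bullet> q1 - K u \<bullet> w" "d \<bullet> (p1 - u) = - (d \<bullet> (u - p1))"
    by (simp_all add: inner_diff_right)
  define P Q P' Q' where "P = (norm (p1 - p))\<^sup>2 / (2 * \<tau>)" and "Q = (norm (q1 - q))\<^sup>2 / (2 * \<sigma>)"
    and "P' = (1 / \<tau>) * ((p - p1) \<bullet> (u - p1))" and "Q' = (1 / \<sigma>) * ((q - q1) \<bullet> (w - q1))"
  have "P' = P + (norm (u - p1))\<^sup>2 / (2 * \<tau>) - (norm (u - p))\<^sup>2 / (2 * \<tau>)"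
    "Q' = Q + (norm (w - q1))\<^sup>2 / (2 * \<sigma>) - (norm (w - q))\<^sup>2 / (2 * \<sigma>)"
    unfolding P_def P'_def Q_def Q'_def polarization
    by (simp_all add: add_divide_distrib diff_divide_distrib)
  moreover have "(1 / \<tau> - l - c) / 2 * (norm (p1 - p))\<^sup>2 =
      P - l / 2 * (norm (p1 - p))\<^sup>2 - c / 2 * (norm (p1 - p))\<^sup>2"
    by (simp add: P_def left_diff_distrib diff_divide_distrib)
  moreover have "(1 / (2 * \<sigma>) - (onorm K)\<^sup>2 / (2 * c)) * (norm (q1 - q))\<^sup>2 =
      Q - (onorm K)\<^sup>2 / (2 * c) * (norm (q1 - q))\<^sup>2"
    by (simp add: Q_def left_diff_distrib)
  ultimately show ?thesis
    using hy hx hF gap e Yo Kterms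
    unfolding x y g energy_def P'_def[symmetric] Q'_def[symmetric] by linarith
qed

subsection \<open>Proximal points\<close>

lemma proper_not_MInfty: "proper \<phi> \<Longrightarrow> \<phi> u \<noteq> -\<infinity>"
  by (simp add: proper_def)

lemma proper_finite_point:
  assumes "proper \<phi>"
  obtains u a where "\<phi> u = ereal a"
  using assms unfolding proper_def by (metis ereal_cases)

lemma proper_less_PInfty:
  assumes "proper \<phi>" "\<phi> u < \<infinity>"
  obtains a where "\<phi> u = ereal a"
  using assms proper_not_MInfty[of \<phi> u] by (cases "\<phi> u") auto

section \<open>Lower semicontinuity along sequences and existence of proximal points\<close>

text \<open>Upper bounds \<open>c n\<close> replace the values of \<open>\<phi>\<close>, so these
  values may fail to converge.\<close>

lemma lsc_seq_le:
  fixes \<phi> :: "'a::topological_space \<Rightarrow> ereal"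
  assumes "lsc \<phi>" "X \<longlonglongrightarrow> z" "\<And>n. \<phi> (X n) \<le> c n" "c \<longlonglongrightarrow> l"
  shows "\<phi> z \<le> l"
proof (rule ccontr)
  assume "\<not> \<phi> z \<le> l"
  then obtain y where y: "l < y" "y < \<phi> z"
    using dense[of l "\<phi> z"] by (auto simp: not_le)
  have "\<phi> z \<le> Liminf (at z) \<phi>" using assms(1) by (simp add: lsc_def)
  then have "eventually (\<lambda>u. y < \<phi> u) (at z)"
    using y by (simp add: le_Liminf_iff)
  \<comment> \<open>The liminf at \<open>z\<close> leaves out \<open>z\<close> itself, but the
    sequence may hit \<open>z\<close>; there \<open>y < \<phi> z\<close> applies.\<close>
  with y have "eventually (\<lambda>u. y < \<phi> u) (nhds z)"
    by (simp add: eventually_nhds_conv_at)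
  then have "eventually (\<lambda>n. y < \<phi> (X n)) sequentially"
    using assms(2) by (rule eventually_compose_filterlim)
  then have "eventually (\<lambda>n. y \<le> c n) sequentially"
    by (rule eventually_mono) (use assms(3) in \<open>meson less_imp_le order_trans\<close>)
  then have "y \<le> l"
    using assms(4) by (intro tendsto_lowerbound[of c]) auto
  with y show False by simp
qed

text \<open>The direct method. Along a minimizing sequence the values converge, so semicontinuity is
  demanded only for such sequences; this form suits both \<open>g\<close> and the proximal
  objective.\<close>

lemma compact_attains_inf_seq_lsc:
  fixes \<phi> :: "'a::metric_space \<Rightarrow> ereal"
  assumes S: "compact S" "S \<noteq> {}"
    and lsc: "\<And>X z l. X \<longlonglongrightarrow> z \<Longrightarrow> (\<lambda>n. \<phi> (X n)) \<longlonglongrightarrow> l \<Longrightarrow> \<phi> z \<le> l"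
  shows "\<exists>z\<in>S. \<forall>u\<in>S. \<phi> z \<le> \<phi> u"
proof -
  obtain a where a: "\<And>n. a n \<in> \<phi> ` S" "a \<longlonglongrightarrow> Inf (\<phi> ` S)"
    using Inf_as_limit[of "\<phi> ` S"] S(2) by blast
  from a(1) have "\<forall>n. \<exists>u. u \<in> S \<and> a n = \<phi> u" by blast
  then obtain X where X: "\<And>n. X n \<in> S" "\<And>n. a n = \<phi> (X n)" by metis
  obtain z r where z: "z \<in> S" "strict_mono r" "(X \<circ> r) \<longlonglongrightarrow> z"
    using S(1) X(1) unfolding compact_eq_seq_compact_metric seq_compact_def by metis
  have "(\<lambda>n. \<phi> ((X \<circ> r) n)) \<longlonglongrightarrow> Inf (\<phi> ` S)"
    using LIMSEQ_subseq_LIMSEQ[OF a(2) z(2)] by (simp add: X(2) o_def)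
  from lsc[OF z(3) this] have "\<forall>u\<in>S. \<phi> z \<le> \<phi> u"
    using Inf_lower order_trans by (metis imageI)
  with z(1) show ?thesis by blast
qed

lemma prox_objective_seq_lsc:
  fixes g :: "'a::real_inner \<Rightarrow> ereal"
  assumes "lsc g" "X \<longlonglongrightarrow> z" "(\<lambda>n. prox_objective lam g v (X n)) \<longlonglongrightarrow> l"
  shows "prox_objective lam g v z \<le> l"
proof -
  let ?q = "\<lambda>u. 1 / (2 * lam) * (norm (u - v))\<^sup>2"
  have q: "(\<lambda>n. ereal (?q (X n))) \<longlonglongrightarrow> ereal (?q z)"
    using assms(2) by (intro tendsto_intros)
  have "(\<lambda>n. prox_objective lam g v (X n) - ereal (?q (X n))) \<longlonglongrightarrow> l - ereal (?q z)"
    by (rule tendsto_diff_ereal_general[OF assms(3) q]) auto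
  moreover have "g (X n) \<le> prox_objective lam g v (X n) - ereal (?q (X n))" for n
    by (cases "g (X n)") (auto simp: prox_objective_def)
  ultimately have "g z \<le> l - ereal (?q z)"
    by (intro lsc_seq_le[OF assms(1,2)])
  then show ?thesis
    unfolding prox_objective_def by (cases "g z"; cases l) (auto simp: algebra_simps)
qed

lemma econvexD_real:
  assumes "econvex \<phi>" "\<phi> p = ereal a" "\<phi> q = ereal b" "0 \<le> t" "t \<le> 1"
  shows "\<phi> ((1 - t) *\<^sub>R p + t *\<^sub>R q) \<le> ereal ((1 - t) * a + t * b)"
proof -
  have "\<phi> ((1 - t) *\<^sub>R p + t *\<^sub>R q) \<le> ereal (1 - t) * \<phi> p + ereal t * \<phi> q"
    using assms(1,4,5) unfolding econvex_def by simp
  then show ?thesis using assms(2,3) by simp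
qed

text \<open>Below \<open>g\<close> there is a cone with vertex above \<open>x0\<close>, whose slope comes from the minimum of
  \<open>g\<close> on the unit ball around \<open>x0\<close>; the quadratic term beats it far away from \<open>x0\<close>.\<close>

lemma prox_minimizer_exists:
  fixes g :: "'a::real_inner \<Rightarrow> ereal"
  assumes cpt: "\<And>(a::'a) r. compact (cball a r)"
    and g: "proper g" "econvex g" "lsc g" and lam: "lam > 0"
  shows "\<exists>z. \<forall>u. prox_objective lam g v z \<le> prox_objective lam g v u"
proof -
  obtain x0 G0 where x0: "g x0 = ereal G0" using proper_finite_point[OF g(1)] .
  have "\<exists>z\<in>cball x0 1. \<forall>u\<in>cball x0 1. g z \<le> g u"
    by (rule compact_attains_inf_seq_lsc[OF cpt]) (auto intro: lsc_seq_le[OF g(3) _ order_refl])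
  then obtain z1 where z1: "\<And>u. u \<in> cball x0 1 \<Longrightarrow> g z1 \<le> g u" by blast
  have "g z1 < \<infinity>" using z1[of x0] x0 by auto
  then obtain m where m: "g z1 = ereal m" using proper_less_PInfty[OF g(1)] by blast
  define k where "k = G0 - m"
  define \<rho> where "\<rho> = norm (x0 - v)"
  \<comment> \<open>For \<open>d > R\<close> one has
    \<open>d * d - 2 * \<rho> * d \<ge> 2 * lam * k * d\<close>, so the growth of the quadratic term
    outweighs the possible drop \<open>k * d\<close> of \<open>g\<close>. The summand 1 keeps such
    points outside the unit ball.\<close>
  define R where "R = 1 + 2 * \<rho> + 2 * lam * k"
  have k: "k \<ge> 0" using z1[of x0] x0 m by (simp add: k_def)
  have R: "R \<ge> 1" using k lam by (simp add: R_def \<rho>_def)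
  have "\<exists>z\<in>cball x0 R. \<forall>u\<in>cball x0 R. prox_objective lam g v z \<le> prox_objective lam g v u"
    by (rule compact_attains_inf_seq_lsc[OF cpt])
      (use prox_objective_seq_lsc[OF g(3)] R in \<open>auto simp del: mem_cball\<close>)
  then obtain z where z: "\<And>u. u \<in> cball x0 R \<Longrightarrow> prox_objective lam g v z \<le> prox_objective lam g v u"
    by blast
  have far: "prox_objective lam g v x0 \<le> prox_objective lam g v u" if u: "u \<notin> cball x0 R" for u
  proof (cases "g u = \<infinity>")
    case False
    then obtain \<gamma> where \<gamma>: "g u = ereal \<gamma>" using proper_less_PInfty[OF g(1), of u] by auto
    define d where "d = norm (u - x0)"
    have d: "d > R" using u by (simp add: d_def dist_norm norm_minus_commute)
    \<comment> \<open>The point at distance 1 from \<open>x0\<close> on the segment towards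
      \<open>u\<close>: there \<open>g\<close> is at least \<open>m\<close>, and convexity carries
      this bound out to \<open>u\<close>.\<close>
    let ?w = "(1 - 1 / d) *\<^sub>R x0 + (1 / d) *\<^sub>R u"
    have "?w - x0 = (1 / d) *\<^sub>R (u - x0)" by (simp add: algebra_simps)
    then have "norm (?w - x0) = 1" using d R by (auto simp: d_def)
    then have "?w \<in> cball x0 1" by (simp add: dist_norm norm_minus_commute)
    then have "ereal m \<le> g ?w" using z1 m by metis
    also have "\<dots> \<le> ereal ((1 - 1 / d) * G0 + (1 / d) * \<gamma>)"
      using d R by (intro econvexD_real[OF g(2) x0 \<gamma>]) auto
    finally have "m \<le> (1 - 1 / d) * G0 + (1 / d) * \<gamma>" by simp
    then have "d * m \<le> d * ((1 - 1 / d) * G0 + (1 / d) * \<gamma>)"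
      using d R by (intro mult_left_mono) auto
    also have "\<dots> = (d - 1) * G0 + \<gamma>" using d R by (simp add: field_simps)
    finally have lower: "G0 - k * d \<le> \<gamma>" by (simp add: k_def algebra_simps)
    have "d - \<rho> \<le> norm (u - v)"
      using norm_triangle_ineq2[of "u - x0" "v - x0"] by (simp add: d_def \<rho>_def norm_minus_commute)
    moreover have "0 \<le> d - \<rho>"
      using d mult_nonneg_nonneg[of lam k] k lam norm_ge_zero[of "x0 - v"]
      unfolding R_def \<rho>_def by linarith
    ultimately have sq: "(d - \<rho>)\<^sup>2 \<le> (norm (u - v))\<^sup>2" by (rule power_mono)
    have "d * (2 * \<rho> + 2 * lam * k) \<le> d * d"
      using d R by (intro mult_left_mono) (auto simp: R_def)
    then have "\<rho>\<^sup>2 + 2 * lam * (k * d) \<le> (d - \<rho>)\<^sup>2"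
      by (simp add: power2_eq_square algebra_simps)
    with sq have "(\<rho>\<^sup>2 + 2 * lam * (k * d)) / (2 * lam) \<le> (norm (u - v))\<^sup>2 / (2 * lam)"
      using lam by (intro divide_right_mono) auto
    then have "\<rho>\<^sup>2 / (2 * lam) + k * d \<le> (norm (u - v))\<^sup>2 / (2 * lam)"
      using lam by (simp add: add_divide_distrib)
    with lower show ?thesis
      unfolding prox_objective_def x0 \<gamma> by (simp add: \<rho>_def)
  qed (simp add: prox_objective_def)
  have "prox_objective lam g v z \<le> prox_objective lam g v u" for u
    using z[of x0] z[of u] far[of u] R by (cases "u \<in> cball x0 R") (auto intro: order_trans)
  then show ?thesis by blast
qed

lemma nonneg_slope_limit:
  fixes a b :: real
  assumes "\<And>t. 0 < t \<Longrightarrow> t < 1 \<Longrightarrow> 0 \<le> a + t * b"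
  shows "0 \<le> a"
proof -
  have "((\<lambda>t. a + t * b) \<longlongrightarrow> a + 0 * b) (at_right 0)"
    by (intro tendsto_intros)
  moreover have "eventually (\<lambda>t. 0 \<le> a + t * b) (at_right 0)"
    unfolding eventually_at_right[OF zero_less_one] using assms by (intro exI[of _ 1]) auto
  ultimately have "0 \<le> a + 0 * b"
    by (rule tendsto_lowerbound) simp
  then show ?thesis by simp
qed

text \<open>Fermat's rule: the minimizer is compared with the points at parameter \<open>t\<close>
  on the segment towards \<open>u\<close>. After division by \<open>t\<close>, the quadratic
  remainder disappears as \<open>t\<close> tends to 0.\<close>

lemma prox_minimizer_subgradient:
  fixes g :: "'a::real_inner \<Rightarrow> ereal"
  assumes g: "proper g" "econvex g" and lam: "lam > 0"
    and min: "\<And>u. prox_objective lam g v z \<le> prox_objective lam g v u"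
  shows "g z < \<infinity>" "(1 / lam) *\<^sub>R (v - z) \<in> eps_subdiff 0 g z"
proof -
  obtain x0 G0 where x0: "g x0 = ereal G0" using proper_finite_point[OF g(1)] .
  show fin: "g z < \<infinity>" using min[of x0] by (auto simp: prox_objective_def x0)
  then obtain Z where Z: "g z = ereal Z" using proper_less_PInfty[OF g(1)] by blast
  have "g z + ereal ((1 / lam) *\<^sub>R (v - z) \<bullet> (u - z)) - ereal 0 \<le> g u" for u
  proof (cases "g u = \<infinity>")
    case False
    then obtain U where U: "g u = ereal U" using proper_less_PInfty[OF g(1), of u] by auto
    let ?a = "U - Z - (1 / lam) * ((v - z) \<bullet> (u - z))"
    have "0 \<le> ?a + t * ((norm (u - z))\<^sup>2 / (2 * lam))" if t: "0 < t" "t < 1" for t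
    proof -
      let ?w = "(1 - t) *\<^sub>R z + t *\<^sub>R u"
      have "prox_objective lam g v z \<le> prox_objective lam g v ?w" by (rule min)
      also have "\<dots> \<le> ereal (1 / (2 * lam) * (norm (?w - v))\<^sup>2) + ereal ((1 - t) * Z + t * U)"
        unfolding prox_objective_def using t
        by (intro add_left_mono econvexD_real[OF g(2) Z U]) auto
      finally have *: "1 / (2 * lam) * (norm (z - v))\<^sup>2 + Z
          \<le> 1 / (2 * lam) * (norm (?w - v))\<^sup>2 + ((1 - t) * Z + t * U)"
        by (simp add: prox_objective_def Z)
      have w: "?w - v = (z - v) + t *\<^sub>R (u - z)" by (simp add: algebra_simps)
      have "(norm (?w - v))\<^sup>2 = (norm (z - v))\<^sup>2 - 2 * t * ((v - z) \<bullet> (u - z)) + t * t * (norm (u - z))\<^sup>2"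
        unfolding w power2_norm_eq_inner
        by (simp add: inner_add_left inner_add_right inner_diff_left inner_diff_right
            inner_commute algebra_simps)
      then have "1 / (2 * lam) * (norm (?w - v))\<^sup>2 = 1 / (2 * lam) * (norm (z - v))\<^sup>2
          - t * ((1 / lam) * ((v - z) \<bullet> (u - z))) + t * (t * ((norm (u - z))\<^sup>2 / (2 * lam)))"
        by (simp add: add_divide_distrib diff_divide_distrib mult.assoc)
      with * have "0 \<le> t * (?a + t * ((norm (u - z))\<^sup>2 / (2 * lam)))"
        by (simp add: algebra_simps)
      then show ?thesis using t by (simp add: zero_le_mult_iff)
    qed
    then have "0 \<le> ?a" by (rule nonneg_slope_limit)
    then show ?thesis by (simp add: Z U)
  qed simp
  then show "(1 / lam) *\<^sub>R (v - z) \<in> eps_subdiff 0 g z"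
    unfolding eps_subdiff_def by blast
qed

section \<open>Inexact proximal points as approximate subgradients\<close>

lemma eps_subdiff_finite:
  assumes "proper \<phi>" "p \<in> eps_subdiff \<epsilon> \<phi> z"
  obtains a where "\<phi> z = ereal a"
proof (rule proper_less_PInfty[OF assms(1), of z])
  obtain x0 G0 where x0: "\<phi> x0 = ereal G0" using proper_finite_point[OF assms(1)] .
  have "\<phi> z + ereal (p \<bullet> (x0 - z)) - ereal \<epsilon> \<le> \<phi> x0"
    using assms(2) unfolding eps_subdiff_def by blast
  then show "\<phi> z < \<infinity>" by (auto simp: x0)
qed

lemma eps_subdiffD_real:
  assumes "p \<in> eps_subdiff \<epsilon> \<phi> z" "\<phi> z = ereal a" "\<phi> u = ereal b"
  shows "a + p \<bullet> (u - z) - \<epsilon> \<le> b"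
proof -
  have "\<phi> z + ereal (p \<bullet> (u - z)) - ereal \<epsilon> \<le> \<phi> u"
    using assms(1) unfolding eps_subdiff_def by blast
  then show ?thesis by (simp add: assms)
qed

lemma eps_subdiffI_real:
  assumes "proper \<phi>" "\<phi> z = ereal a" "\<And>u b. \<phi> u = ereal b \<Longrightarrow> a + p \<bullet> (u - z) - \<epsilon> \<le> b"
  shows "p \<in> eps_subdiff \<epsilon> \<phi> z"
proof -
  have "\<phi> z + ereal (p \<bullet> (u - z)) - ereal \<epsilon> \<le> \<phi> u" for u
    using assms(3)[of u] proper_not_MInfty[OF assms(1), of u] by (cases "\<phi> u") (auto simp: assms(2))
  then show ?thesis by (auto simp: eps_subdiff_def)
qed

text \<open>For type 1 the witness \<open>r\<close> is \<open>z\<close> minus the exact proximal point.\<close>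

lemma inexact_prox_eps_subdiff:
  fixes g :: "'a::real_inner \<Rightarrow> ereal"
  assumes cpt: "\<And>(a::'a) r. compact (cball a r)"
    and g: "proper g" "econvex g" "lsc g" and lam: "lam > 0" and i: "i \<in> {1, 2, 3}"
    and prox: "inexact_prox i \<epsilon> lam g v z"
  shows "\<exists>r. norm r \<le> (if i = 2 then 0 else sqrt (2 * lam * \<epsilon>)) \<and>
      (1 / lam) *\<^sub>R (v + r - z) \<in> eps_subdiff (if i = 3 then 0 else \<epsilon>) g z"
proof -
  consider (1) "i = 1" "0 \<in> eps_subdiff \<epsilon> (prox_objective lam g v) z"
    | (2) "i = 2" "(1 / lam) *\<^sub>R (v - z) \<in> eps_subdiff \<epsilon> g z"
    | (3) r where "i = 3" "norm r \<le> sqrt (2 * lam * \<epsilon>)" "z = prox lam g (v + r)"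
    using prox by (auto simp: inexact_prox_def)
  then show ?thesis
  proof cases
    case 1
    obtain s where "\<And>u. prox_objective lam g v s \<le> prox_objective lam g v u"
      using prox_minimizer_exists[OF cpt g lam] by blast
    note s = prox_minimizer_subgradient[OF g(1,2) lam this]
    obtain S where S: "g s = ereal S" using proper_less_PInfty[OF g(1) s(1)] by blast
    have zs: "prox_objective lam g v z - ereal \<epsilon> \<le> prox_objective lam g v s"
      using 1(2) unfolding eps_subdiff_def by (simp add: zero_ereal_def[symmetric])
    then have "g z < \<infinity>" by (auto simp: prox_objective_def S)
    then obtain Z where Z: "g z = ereal Z" using proper_less_PInfty[OF g(1)] by blast
    have "(norm (z - v))\<^sup>2 / (2 * lam) + Z - \<epsilon> \<le> (norm (s - v))\<^sup>2 / (2 * lam) + S"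
      using zs by (simp add: prox_objective_def S Z)
    moreover have "(norm (z - v))\<^sup>2 = (norm (z - s))\<^sup>2 - 2 * ((v - s) \<bullet> (z - s)) + (norm (s - v))\<^sup>2"
      by (simp add: power2_norm_eq_inner algebra_simps inner_commute)
    ultimately have *: "(norm (z - s))\<^sup>2 / (2 * lam) - (1 / lam) * ((v - s) \<bullet> (z - s)) + Z - \<epsilon> \<le> S"
      by (simp add: add_divide_distrib diff_divide_distrib)
    \<comment> \<open>Added to the preceding estimate, the subgradient inequality at
      \<open>s\<close> tested at \<open>z\<close> cancels everything except the square and
      \<open>\<epsilon>\<close>; this bounds the witness \<open>z - s\<close>.\<close>
    have "S + (1 / lam) * ((v - s) \<bullet> (z - s)) \<le> Z"
      using eps_subdiffD_real[OF s(2) S Z] by simp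
    with * have "(norm (z - s))\<^sup>2 \<le> 2 * lam * \<epsilon>"
      using lam by (simp add: field_simps)
    then have "norm (z - s) \<le> sqrt (2 * lam * \<epsilon>)"
      by (simp add: real_le_rsqrt)
    \<comment> \<open>The vector equals \<open>(v - s) / lam\<close>, an exact subgradient at
      \<open>s\<close>. Moving the base point from \<open>s\<close> to \<open>z\<close> costs at
      most \<open>\<epsilon>\<close>.\<close>
    moreover have "(1 / lam) *\<^sub>R (v + (z - s) - z) \<in> eps_subdiff \<epsilon> g z"
    proof (rule eps_subdiffI_real[OF g(1) Z])
      fix u U assume U: "g u = ereal U"
      have "S + (1 / lam) * ((v - s) \<bullet> (u - s)) \<le> U"
        using eps_subdiffD_real[OF s(2) S U] by simp
      moreover have "(v - s) \<bullet> (u - s) = (v - s) \<bullet> (u - z) + (v - s) \<bullet> (z - s)"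
        by (simp add: inner_diff_right)
      moreover have "0 \<le> (norm (z - s))\<^sup>2 / (2 * lam)" using lam by simp
      ultimately show "Z + (1 / lam) *\<^sub>R (v + (z - s) - z) \<bullet> (u - z) - \<epsilon> \<le> U"
        using * by (simp add: distrib_left)
    qed
    ultimately show ?thesis using 1(1) by auto
  next
    case 2
    then show ?thesis by (intro exI[of _ 0]) auto
  next
    case 3
    \<comment> \<open>\<open>prox\<close> is a choice among minimizers, so the existence of one is
      what makes \<open>z\<close> a minimizer.\<close>
    obtain s where "\<And>u. prox_objective lam g (v + r) s \<le> prox_objective lam g (v + r) u"
      using prox_minimizer_exists[OF cpt g lam] by blast
    then have "is_arg_min (prox_objective lam g (v + r)) (\<lambda>_. True) s"
      by (auto simp: is_arg_min_def not_less)
    then have "is_arg_min (prox_objective lam g (v + r)) (\<lambda>_. True) z"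
      unfolding 3(3) prox_def arg_min_def by (rule someI)
    then have "\<And>u. prox_objective lam g (v + r) z \<le> prox_objective lam g (v + r) u"
      by (auto simp: is_arg_min_def not_less)
    from prox_minimizer_subgradient(2)[OF g(1,2) lam this] 3(1,2) show ?thesis by auto
  qed
qed

section \<open>The conjugate function\<close>

text \<open>In a supremum of continuous functions, a single member already exceeds \<open>c\<close>
  at \<open>y\<close>, and it does so nearby as well. Members with infinite \<open>h u\<close> are
  constant.\<close>

lemma lsc_conjugate: "lsc (conjugate h)"
  unfolding lsc_def
proof
  fix y
  show "conjugate h y \<le> Liminf (at y) (conjugate h)"
    unfolding le_Liminf_iff
  proof (intro allI impI)
    fix c assume "c < conjugate h y"
    then obtain u where u: "c < ereal (u \<bullet> y) - h u"
      unfolding conjugate_def by (auto simp: less_SUP_iff)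
    have "((\<lambda>w. ereal (u \<bullet> w) - h u) \<longlongrightarrow> ereal (u \<bullet> y) - h u) (at y)"
      by (intro tendsto_diff_ereal_general tendsto_const tendsto_ereal tendsto_intros) auto
    then have "eventually (\<lambda>w. c < ereal (u \<bullet> w) - h u) (at y)"
      using u by (rule order_tendstoD)
    then show "eventually (\<lambda>w. c < conjugate h w) (at y)"
      by (rule eventually_mono) (auto simp: conjugate_def less_SUP_iff)
  qed
qed

text \<open>The proximal point \<open>z\<close> of 0 has the subgradient \<open>- z\<close>. The
  resulting affine minorant of \<open>h\<close> makes the conjugate finite at \<open>- z\<close>,
  while finiteness of \<open>h z\<close> excludes the value minus infinity.\<close>

lemma proper_conjugate:
  fixes h :: "'a::real_inner \<Rightarrow> ereal"
  assumes cpt: "\<And>(a::'a) r. compact (cball a r)"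
    and h: "proper h" "econvex h" "lsc h"
  shows "proper (conjugate h)"
proof -
  obtain z where "\<And>u. prox_objective 1 h 0 z \<le> prox_objective 1 h 0 u"
    using prox_minimizer_exists[OF cpt h, of 1] by auto
  from prox_minimizer_subgradient[OF h(1,2) _ this]
  have z: "h z < \<infinity>" "- z \<in> eps_subdiff 0 h z" by auto
  obtain Z where Z: "h z = ereal Z" using proper_less_PInfty[OF h(1) z(1)] by blast
  have "ereal (u \<bullet> - z) - h u \<le> ereal (z \<bullet> - z - Z)" for u
  proof (cases "h u")
    case (real U)
    with eps_subdiffD_real[OF z(2) Z real] show ?thesis
      by (simp add: inner_diff_right inner_commute)
  qed (use proper_not_MInfty[OF h(1), of u] in auto)
  then have "conjugate h (- z) \<le> ereal (z \<bullet> - z - Z)"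
    unfolding conjugate_def by (rule SUP_least)
  then have "conjugate h (- z) \<noteq> \<infinity>" by auto
  moreover have "conjugate h y \<noteq> -\<infinity>" for y
  proof -
    have "ereal (z \<bullet> y) - h z \<le> conjugate h y"
      unfolding conjugate_def by (rule SUP_upper) simp
    then show ?thesis by (auto simp: Z)
  qed
  ultimately show ?thesis unfolding proper_def by blast
qed

subsection \<open>Functions with Lipschitz gradient\<close>

lemma edom_eq_ereal:
  assumes "proper f" "u \<in> edom f"
  shows "f u = ereal (real_of_ereal (f u))"
  using assms proper_not_MInfty[OF assms(1), of u] by (cases "f u") (auto simp: edom_def)

lemma GDERIV_line:
  assumes "GDERIV F (u + t *\<^sub>R d) :> D"
  shows "((\<lambda>s. F (u + s *\<^sub>R d)) has_real_derivative D \<bullet> d) (at t)"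
proof -
  have "((\<lambda>s. u + s *\<^sub>R d) has_derivative (\<lambda>s. s *\<^sub>R d)) (at t)"
    by (auto intro!: derivative_eq_intros)
  from has_derivative_compose[OF this] assms
  have "((\<lambda>s. F (u + s *\<^sub>R d)) has_derivative (\<lambda>s. (s *\<^sub>R d) \<bullet> D)) (at t)"
    unfolding gderiv_def by blast
  moreover have "(\<lambda>s. (s *\<^sub>R d) \<bullet> D) = (*) (D \<bullet> d)"
    by (simp add: fun_eq_iff inner_commute)
  ultimately show ?thesis
    unfolding has_field_derivative_def by simp
qed

lemma econvex_gradient_le:
  assumes f: "proper f" "econvex f" and uv: "u \<in> edom f" "v \<in> edom f"
    and d: "has_egradient f u d"
  shows "real_of_ereal (f u) + d \<bullet> (v - u) \<le> real_of_ereal (f v)"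
proof -
  let ?F = "\<lambda>u. real_of_ereal (f u)"
  have "((\<lambda>s. ?F (u + s *\<^sub>R (v - u))) has_real_derivative d \<bullet> (v - u)) (at 0)"
    using d by (intro GDERIV_line) (simp add: has_egradient_def)
  then have "((\<lambda>t. (?F (u + t *\<^sub>R (v - u)) - ?F u) / t) \<longlongrightarrow> d \<bullet> (v - u)) (at 0)"
    by (simp add: DERIV_def)
  then have "((\<lambda>t. (?F (u + t *\<^sub>R (v - u)) - ?F u) / t) \<longlongrightarrow> d \<bullet> (v - u)) (at_right 0)"
    by (rule filterlim_mono) (auto simp: at_le)
  moreover have "eventually (\<lambda>t. (?F (u + t *\<^sub>R (v - u)) - ?F u) / t \<le> ?F v - ?F u) (at_right 0)"
  proof -
    have "(?F (u + t *\<^sub>R (v - u)) - ?F u) / t \<le> ?F v - ?F u" if t: "0 < t" "t < 1" for t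
    proof -
      have "f ((1 - t) *\<^sub>R u + t *\<^sub>R v) \<le> ereal ((1 - t) * ?F u + t * ?F v)"
        using t by (intro econvexD_real[OF f(2)] edom_eq_ereal[OF f(1)] uv) auto
      moreover have "(1 - t) *\<^sub>R u + t *\<^sub>R v = u + t *\<^sub>R (v - u)" by (simp add: algebra_simps)
      ultimately have "?F (u + t *\<^sub>R (v - u)) \<le> (1 - t) * ?F u + t * ?F v"
        using proper_not_MInfty[OF f(1), of "u + t *\<^sub>R (v - u)"]
        by (cases "f (u + t *\<^sub>R (v - u))") auto
      then show ?thesis using t by (simp add: field_simps)
    qed
    then show ?thesis
      unfolding eventually_at_right[OF zero_less_one] by (intro exI[of _ 1]) auto
  qed
  ultimately have "d \<bullet> (v - u) \<le> ?F v - ?F u"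
    by (intro tendsto_upperbound[of _ "d \<bullet> (v - u)" "at_right 0"]) auto
  then show ?thesis by simp
qed

text \<open>The domain is nonempty, open by the interior condition in \<open>has_egradient\<close>,
  and closed because the Lipschitz gradient keeps \<open>f\<close> bounded along convergent
  sequences; connectedness finishes. Hence \<open>f\<close> can be handled as a real-valued
  function.\<close>

lemma edom_eq_UNIV:
  fixes f :: "'a::real_inner \<Rightarrow> ereal"
  assumes f: "proper f" "econvex f" "lsc f"
    and grad: "\<And>u. u \<in> edom f \<Longrightarrow> has_egradient f u (gradf u)"
    and lip: "\<And>u v. u \<in> edom f \<Longrightarrow> v \<in> edom f \<Longrightarrow> norm (gradf u - gradf v) \<le> l * norm (u - v)"
  shows "edom f = UNIV"
proof -
  let ?F = "\<lambda>u. real_of_ereal (f u)"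
  obtain a A where "f a = ereal A" using proper_finite_point[OF f(1)] .
  then have a: "a \<in> edom f" by (simp add: edom_def)
  have "u \<in> interior (edom f)" if "u \<in> edom f" for u
    using grad[OF that] by (simp add: has_egradient_def)
  then have "interior (edom f) = edom f"
    using interior_subset[of "edom f"] by (intro equalityI subsetI) auto
  then have "open (edom f)" using open_interior[of "edom f"] by simp
  moreover have "closed (edom f)"
    unfolding closed_sequential_limits
  proof (intro allI impI, elim conjE)
    fix X z assume X: "\<forall>n. X n \<in> edom f" "X \<longlonglongrightarrow> z"
    \<comment> \<open>Convexity at \<open>X n\<close> tested at \<open>a\<close>, Cauchy-Schwarz,
      and the Lipschitz comparison of \<open>gradf (X n)\<close> with \<open>gradf a\<close> give
      this bound, which is continuous in the point.\<close>
    let ?c = "\<lambda>u. ?F a + (norm (gradf a) + l * norm (u - a)) * norm (u - a)"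
    have "f (X n) \<le> ereal (?c (X n))" for n
    proof -
      have Xn: "X n \<in> edom f" using X by blast
      have "?F (X n) + gradf (X n) \<bullet> (a - X n) \<le> ?F a"
        by (intro econvex_gradient_le f Xn a grad)
      moreover have "- (gradf (X n) \<bullet> (a - X n)) \<le> norm (gradf (X n)) * norm (X n - a)"
        using Cauchy_Schwarz_ineq2[of "gradf (X n)" "a - X n"] by (simp add: norm_minus_commute)
      moreover have "norm (gradf (X n)) \<le> norm (gradf a) + l * norm (X n - a)"
        using lip[OF Xn a] norm_triangle_ineq2[of "gradf (X n)" "gradf a"] by simp
      then have "norm (gradf (X n)) * norm (X n - a) \<le> (norm (gradf a) + l * norm (X n - a)) * norm (X n - a)"
        by (intro mult_right_mono) auto
      ultimately have "?F (X n) \<le> ?c (X n)" by linarith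
      then show ?thesis using edom_eq_ereal[OF f(1) Xn] by (metis ereal_less_eq(3))
    qed
    moreover have "(\<lambda>n. ereal (?c (X n))) \<longlonglongrightarrow> ereal (?c z)"
      using X(2) by (intro tendsto_intros)
    ultimately have "f z \<le> ereal (?c z)" by (rule lsc_seq_le[OF f(3) X(2)])
    then show "z \<in> edom f" unfolding edom_def by auto
  qed
  ultimately show ?thesis using a clopen[of "edom f"] by blast
qed

text \<open>The descent lemma. Along the segment, the difference \<open>\<phi>\<close> of
  \<open>F\<close> and its quadratic model has nonpositive derivative, so it does not increase from
  0 to 1.\<close>

lemma Lipschitz_gradient_descent:
  fixes F :: "'a::real_inner \<Rightarrow> real"
  assumes grad: "\<And>u. GDERIV F u :> gradf u"
    and lip: "\<And>u v. norm (gradf u - gradf v) \<le> l * norm (u - v)"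
  shows "F v \<le> F u + gradf u \<bullet> (v - u) + l / 2 * (norm (v - u))\<^sup>2"
proof -
  define d where "d = v - u"
  define \<phi> where "\<phi> t = F (u + t *\<^sub>R d) - t * (gradf u \<bullet> d) - l / 2 * t\<^sup>2 * (norm d)\<^sup>2" for t
  have "\<phi> 1 \<le> \<phi> 0"
  proof (rule DERIV_nonpos_imp_nonincreasing[of 0 1 \<phi>])
    fix t :: real assume t: "0 \<le> t"
    let ?D = "gradf (u + t *\<^sub>R d) \<bullet> d - gradf u \<bullet> d - l * t * (norm d)\<^sup>2"
    have "(\<phi> has_real_derivative ?D) (at t)"
      unfolding \<phi>_def by (auto intro!: derivative_eq_intros GDERIV_line grad)
    moreover have "?D \<le> 0"
    proof -
      have "gradf (u + t *\<^sub>R d) \<bullet> d - gradf u \<bullet> d \<le> norm (gradf (u + t *\<^sub>R d) - gradf u) * norm d"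
        unfolding inner_diff_left[symmetric] by (rule norm_cauchy_schwarz)
      also have "\<dots> \<le> l * norm (t *\<^sub>R d) * norm d"
        using lip[of "u + t *\<^sub>R d" u] by (intro mult_right_mono) auto
      finally show ?thesis using t by (simp add: power2_eq_square)
    qed
    ultimately show "\<exists>y. (\<phi> has_real_derivative y) (at t) \<and> y \<le> 0" by blast
  qed simp
  then show ?thesis by (simp add: \<phi>_def d_def)
qed

subsection \<open>Saddle points and convergence\<close>

text \<open>The saddle property in real numbers, with \<open>k\<close> in the role of the conjugate
  of \<open>h\<close>; this avoids differences of infinities. The last conjunct says that
  \<open>K xs\<close> is a subgradient of \<open>k\<close> at \<open>ys\<close>.\<close>

definition saddle_ineqs :: "('a::real_inner \<Rightarrow> 'b::real_inner) \<Rightarrow> ('a \<Rightarrow> real) \<Rightarrow> ('a \<Rightarrow> ereal) \<Rightarrow>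
    ('b \<Rightarrow> ereal) \<Rightarrow> 'a \<Rightarrow> 'b \<Rightarrow> real \<Rightarrow> real \<Rightarrow> bool" where
  "saddle_ineqs K F g k xs ys G H \<longleftrightarrow> g xs = ereal G \<and> k ys = ereal H \<and>
     (\<forall>u Gu. g u = ereal Gu \<longrightarrow> K xs \<bullet> ys + F xs + G \<le> K u \<bullet> ys + F u + Gu) \<and>
     (\<forall>w Hw. k w = ereal Hw \<longrightarrow> H + K xs \<bullet> (w - ys) \<le> Hw)"

lemma saddle_point_lagrangian_iff:
  assumes f: "\<And>u. f u = ereal (F u)" and g: "proper g" and k: "proper (conjugate h)"
  shows "saddle_point (lagrangian K f g h) xs ys \<longleftrightarrow>
    (\<exists>G H. saddle_ineqs K F g (conjugate h) xs ys G H)"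
proof
  assume S: "saddle_point (lagrangian K f g h) xs ys"
  obtain u0 G0 where u0: "g u0 = ereal G0" using proper_finite_point[OF g] .
  obtain w0 H0 where w0: "conjugate h w0 = ereal H0" using proper_finite_point[OF k] .
  have le: "lagrangian K f g h xs w \<le> lagrangian K f g h u ys" for u w
    using S unfolding saddle_point_def by (meson order_trans)
  \<comment> \<open>An infinite \<open>g xs\<close> would make the left side of
    \<open>le[of w0 u0]\<close> infinite, whereas its right side is below infinity. Once
    \<open>g xs\<close> is finite, an infinite conjugate at \<open>ys\<close> would make the right
    side minus infinity.\<close>
  have "g xs \<noteq> \<infinity>" using le[of w0 u0] w0 u0 proper_not_MInfty[OF k, of ys]
    by (cases "conjugate h ys") (auto simp: lagrangian_def f)
  then obtain G where G: "g xs = ereal G" using proper_less_PInfty[OF g, of xs] by auto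
  have "conjugate h ys \<noteq> \<infinity>" using le[of w0 u0] w0 u0 G by (auto simp: lagrangian_def f)
  then obtain H where H: "conjugate h ys = ereal H" using proper_less_PInfty[OF k, of ys] by auto
  have "K xs \<bullet> ys + F xs + G \<le> K u \<bullet> ys + F u + Gu" if "g u = ereal Gu" for u Gu
    using le[of ys u] that G H by (simp add: lagrangian_def f)
  moreover have "H + K xs \<bullet> (w - ys) \<le> Hw" if "conjugate h w = ereal Hw" for w Hw
    using le[of w xs] that G H by (simp add: lagrangian_def f inner_diff_right)
  ultimately show "\<exists>G H. saddle_ineqs K F g (conjugate h) xs ys G H"
    using G H unfolding saddle_ineqs_def by blast
next
  assume "\<exists>G H. saddle_ineqs K F g (conjugate h) xs ys G H"
  then obtain G H where S: "saddle_ineqs K F g (conjugate h) xs ys G H" by blast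
  note GH = S[unfolded saddle_ineqs_def, THEN conjunct1]
    S[unfolded saddle_ineqs_def, THEN conjunct2, THEN conjunct1]
  have "lagrangian K f g h xs ys \<le> lagrangian K f g h u ys" for u
  proof (cases "g u")
    case (real Gu)
    then have "K xs \<bullet> ys + F xs + G \<le> K u \<bullet> ys + F u + Gu"
      using S unfolding saddle_ineqs_def by blast
    then show ?thesis by (simp add: lagrangian_def f GH real)
  qed (use proper_not_MInfty[OF g, of u] in \<open>auto simp: lagrangian_def f GH\<close>)
  moreover have "lagrangian K f g h xs w \<le> lagrangian K f g h xs ys" for w
  proof (cases "conjugate h w")
    case (real Hw)
    then have "H + K xs \<bullet> (w - ys) \<le> Hw"
      using S unfolding saddle_ineqs_def by blast
    then show ?thesis by (simp add: lagrangian_def f GH real inner_diff_right)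
  qed (use proper_not_MInfty[OF k, of w] in \<open>auto simp: lagrangian_def f GH\<close>)
  ultimately show "saddle_point (lagrangian K f g h) xs ys"
    unfolding saddle_point_def by blast
qed

text \<open>Used to show optimality of cluster points. For a fixed \<open>u\<close> only the
  products \<open>p n \<bullet> (u - X n)\<close> have to converge.\<close>

lemma eps_subdiff_limit:
  assumes "lsc \<phi>" "X \<longlonglongrightarrow> z" "\<And>n. p n \<in> eps_subdiff (\<eta> n) \<phi> (X n)" "\<eta> \<longlonglongrightarrow> 0"
    and u: "\<phi> u = ereal b" "(\<lambda>n. p n \<bullet> (u - X n)) \<longlonglongrightarrow> s"
  shows "\<phi> z \<le> ereal (b - s)"
proof (rule lsc_seq_le[OF assms(1,2)])
  fix n
  have "\<phi> (X n) + ereal (p n \<bullet> (u - X n)) - ereal (\<eta> n) \<le> \<phi> u"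
    using assms(3)[of n] unfolding eps_subdiff_def by blast
  then show "\<phi> (X n) \<le> ereal (b - p n \<bullet> (u - X n) + \<eta> n)"
    unfolding u(1) by (cases "\<phi> (X n)") auto
next
  have "(\<lambda>n. b - p n \<bullet> (u - X n) + \<eta> n) \<longlonglongrightarrow> b - s + 0"
    by (intro tendsto_intros assms)
  then show "(\<lambda>n. ereal (b - p n \<bullet> (u - X n) + \<eta> n)) \<longlonglongrightarrow> ereal (b - s)"
    by simp
qed

lemma tendsto_if_dist_square_le:
  fixes X :: "nat \<Rightarrow> 'a::real_normed_vector"
  assumes "\<And>n. (norm (z - X n))\<^sup>2 \<le> C * V n" "V \<longlonglongrightarrow> 0"
  shows "X \<longlonglongrightarrow> z"
proof -
  have CV: "(\<lambda>n. C * V n) \<longlonglongrightarrow> 0" using tendsto_mult_left[OF assms(2), of C] by simp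
  have "(\<lambda>n. (norm (z - X n))\<^sup>2) \<longlonglongrightarrow> 0"
    by (rule tendsto_sandwich[OF _ _ tendsto_const CV]) (simp_all add: assms(1))
  then have "(\<lambda>n. norm (z - X n)) \<longlonglongrightarrow> 0" by simp
  then show ?thesis
    unfolding tendsto_dist_iff[of X] dist_norm by (simp add: norm_minus_commute)
qed

text \<open>The iteration with all errors in type-2 form: \<open>F\<close> is the finite smooth
  part, \<open>k\<close> stands for the conjugate of \<open>h\<close>, \<open>xp\<close> is the
  delayed primal sequence, and errors are numbered by the iterate they start from.\<close>

lemma primal_dual_convergence:
  fixes K :: "'a::real_inner \<Rightarrow> 'b::real_inner"
    and F :: "'a \<Rightarrow> real" and g :: "'a \<Rightarrow> ereal" and k :: "'b \<Rightarrow> ereal"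
  assumes cpt: "\<And>(a::'a) r. compact (cball a r)" "\<And>(b::'b) r. compact (cball b r)"
    and K: "bounded_linear K" and K': "\<And>u w. K u \<bullet> w = u \<bullet> K' w"
    and F_grad: "\<And>u v. F u + gradf u \<bullet> (v - u) \<le> F v"
    and F_descent: "\<And>u v. F v \<le> F u + gradf u \<bullet> (v - u) + l / 2 * (norm (v - u))\<^sup>2"
    and gradf: "\<And>u v. norm (gradf u - gradf v) \<le> l * norm (u - v)"
    and g: "proper g" "lsc g" and k: "proper k" "lsc k"
    and saddle: "saddle_ineqs K F g k u0 w0 G0 H0"
    and pos: "\<tau> > 0" "\<sigma> > 0" and steps: "\<tau> * l + \<sigma> * \<tau> * (onorm K)\<^sup>2 < 1"
    and err_nonneg: "\<And>n. \<epsilon> n \<ge> 0" "\<And>n. \<delta> n \<ge> 0"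
    and err: "summable (\<lambda>n. norm (e n))" "summable \<epsilon>" "summable \<delta>"
    and xp: "xp 0 = x 0" "\<And>n. xp (Suc n) = x n"
    and y_step: "\<And>n. (1 / \<sigma>) *\<^sub>R (y n + \<sigma> *\<^sub>R K (2 *\<^sub>R x n - xp n) - y (Suc n))
        \<in> eps_subdiff (\<delta> n) k (y (Suc n))"
    and x_step: "\<And>n. (1 / \<tau>) *\<^sub>R (x n - \<tau> *\<^sub>R (K' (y (Suc n)) + gradf (x n) + e n) - x (Suc n))
        \<in> eps_subdiff (\<epsilon> n) g (x (Suc n))"
  shows "\<exists>xs ys. (\<exists>G H. saddle_ineqs K F g k xs ys G H) \<and> x \<longlonglongrightarrow> xs \<and> y \<longlonglongrightarrow> ys"
proof -
  interpret K: bounded_linear K by fact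
  \<comment> \<open>The midpoint of the interval left open by the step-size condition: the lower
    bound on \<open>c\<close> makes \<open>Q\<close> positive, the upper bound makes
    \<open>P\<close> positive.\<close>
  define c where "c = (\<sigma> * (onorm K)\<^sup>2 + (1 / \<tau> - l)) / 2"
  have lt: "\<sigma> * (onorm K)\<^sup>2 < 1 / \<tau> - l"
    using steps pos by (simp add: field_simps)
  have c_bounds: "\<sigma> * (onorm K)\<^sup>2 < c" "c < 1 / \<tau> - l"
    using lt by (auto simp: c_def field_simps)
  have c: "c > 0" using c_bounds(1) pos by (smt (verit) mult_nonneg_nonneg zero_le_power2)
  define P where "P = (1 / \<tau> - l - c) / 2"
  define Q where "Q = 1 / (2 * \<sigma>) - (onorm K)\<^sup>2 / (2 * c)"
  have P: "P > 0" using c_bounds by (simp add: P_def)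
  have Q: "Q > 0" using c_bounds c pos by (simp add: Q_def field_simps)
  define V where "V u w n = energy K \<tau> \<sigma> c u w (x n) (y n) (xp n)" for u w n
  define D where "D n = P * (norm (x (Suc n) - x n))\<^sup>2 + Q * (norm (y (Suc n) - y n))\<^sup>2" for n
  have D: "D n \<ge> 0" for n using P Q by (simp add: D_def)
  have V_ge: "(norm (u - x n))\<^sup>2 / (2 * \<tau>) + Q * (norm (w - y n))\<^sup>2 \<le> V u w n" for u w n
    unfolding V_def Q_def by (rule energy_ge[OF K c])
  have V_ge_x: "(norm (u - x n))\<^sup>2 \<le> 2 * \<tau> * V u w n" for u w n
  proof -
    have "0 \<le> Q * (norm (w - y n))\<^sup>2" using Q by simp
    with V_ge[of u n w] have "(norm (u - x n))\<^sup>2 / (2 * \<tau>) \<le> V u w n" by linarith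
    then show ?thesis using pos by (simp add: field_simps)
  qed
  have V_ge_y: "(norm (w - y n))\<^sup>2 \<le> 1 / Q * V u w n" for u w n
  proof -
    have "0 \<le> (norm (u - x n))\<^sup>2 / (2 * \<tau>)" using pos by simp
    with V_ge[of u n w] have "Q * (norm (w - y n))\<^sup>2 \<le> V u w n" by linarith
    then show ?thesis using Q by (simp add: field_simps)
  qed
  have V: "V u w n \<ge> 0" for u w n
  proof -
    have "0 \<le> 2 * \<tau> * V u w n" using V_ge_x[of u n w] by (meson order_trans zero_le_power2)
    then show ?thesis using pos by (simp add: zero_le_mult_iff)
  qed
  have Fejer: "convergent (V u w)" "D \<longlonglongrightarrow> 0" "\<exists>M. \<forall>n. V u w n \<le> M"
    if S: "saddle_ineqs K F g k u w G H" for u w G H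
  proof -
    have step: "V u w (Suc n) + D n
        \<le> V u w n + (norm (e n) * sqrt (2 * \<tau>)) * sqrt (V u w (Suc n)) + (\<epsilon> n + \<delta> n)" for n
    proof -
      obtain G1 where G1: "g (x (Suc n)) = ereal G1"
        using eps_subdiff_finite[OF g(1) x_step] .
      obtain H1 where H1: "k (y (Suc n)) = ereal H1"
        using eps_subdiff_finite[OF k(1) y_step] .
      have GH: "g u = ereal G" "k w = ereal H"
        using S by (simp_all add: saddle_ineqs_def)
      have gap: "K u \<bullet> w + F u + G \<le> K (x (Suc n)) \<bullet> w + F (x (Suc n)) + G1"
        "H + K u \<bullet> (y (Suc n) - w) \<le> H1"
        using S G1 H1 unfolding saddle_ineqs_def by blast+
      \<comment> \<open>Descent from \<open>x n\<close> to \<open>x (Suc n)\<close>, with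
        \<open>F (x n)\<close> eliminated by convexity tested at \<open>u\<close>.\<close>
      have "F (x (Suc n)) \<le> F u + gradf (x n) \<bullet> (x (Suc n) - u) + l / 2 * (norm (x (Suc n) - x n))\<^sup>2"
        using F_grad[of "x n" u] F_descent[of "x (Suc n)" "x n"] by (simp add: inner_diff_right)
      from energy_step[OF K K' pos c eps_subdiffD_real[OF y_step H1 GH(2)]
          eps_subdiffD_real[OF x_step G1 GH(1)] this gap]
      have "V u w (Suc n) + D n \<le> V u w n + norm (e n) * norm (u - x (Suc n)) + (\<epsilon> n + \<delta> n)"
        by (simp add: V_def D_def P_def Q_def xp)
      also have "norm (u - x (Suc n)) \<le> sqrt (2 * \<tau>) * sqrt (V u w (Suc n))"
        using V_ge_x[of u "Suc n" w] by (simp add: real_le_rsqrt real_sqrt_mult[symmetric])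
      finally show ?thesis by (simp add: mult_left_mono mult.assoc)
    qed
    note * = quasi_Fejer[of "V u w" D "\<lambda>n. norm (e n) * sqrt (2 * \<tau>)" "\<lambda>n. \<epsilon> n + \<delta> n", OF V D _ _ _ _ step]
    show "convergent (V u w)" "D \<longlonglongrightarrow> 0" "\<exists>M. \<forall>n. V u w n \<le> M"
      using pos err_nonneg by (intro *; auto intro: summable_mult2 summable_add err)+
  qed
  have D0: "D \<longlonglongrightarrow> 0" by (rule Fejer(2)[OF saddle])
  have dx: "(\<lambda>n. x (Suc n) - x n) \<longlonglongrightarrow> 0"
  proof (rule tendsto_if_dist_square_le[OF _ D0])
    fix n
    have "0 \<le> Q * (norm (y (Suc n) - y n))\<^sup>2" using Q by simp
    then have "P * (norm (x (Suc n) - x n))\<^sup>2 \<le> D n" unfolding D_def by linarith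
    then show "(norm (0 - (x (Suc n) - x n)))\<^sup>2 \<le> 1 / P * D n"
      using P by (simp add: norm_minus_commute field_simps)
  qed
  have dy: "(\<lambda>n. y (Suc n) - y n) \<longlonglongrightarrow> 0"
  proof (rule tendsto_if_dist_square_le[OF _ D0])
    fix n
    have "0 \<le> P * (norm (x (Suc n) - x n))\<^sup>2" using P by simp
    then have "Q * (norm (y (Suc n) - y n))\<^sup>2 \<le> D n" unfolding D_def by linarith
    then show "(norm (0 - (y (Suc n) - y n)))\<^sup>2 \<le> 1 / Q * D n"
      using Q by (simp add: norm_minus_commute field_simps)
  qed
  obtain M where M: "\<And>n. V u0 w0 n \<le> M" using Fejer(3)[OF saddle] by blast
  have "norm (x n) \<le> norm u0 + sqrt (2 * \<tau> * M)" for n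
  proof -
    have "(norm (u0 - x n))\<^sup>2 \<le> 2 * \<tau> * M"
      using V_ge_x[of u0 n w0] mult_left_mono[OF M[of n], of "2 * \<tau>"] pos by linarith
    then have "norm (u0 - x n) \<le> sqrt (2 * \<tau> * M)" by (rule real_le_rsqrt)
    then show ?thesis using norm_triangle_sub[of "x n" u0] by (simp add: norm_minus_commute)
  qed
  then obtain xs r1 where r1: "strict_mono r1" "(x \<circ> r1) \<longlonglongrightarrow> xs"
    by (rule bounded_subseq_convergent[where X = x, OF cpt(1)])
  have "norm ((y \<circ> r1) n) \<le> norm w0 + sqrt (1 / Q * M)" for n
  proof -
    have "(norm (w0 - y (r1 n)))\<^sup>2 \<le> 1 / Q * M"
      using V_ge_y[of w0 "r1 n" u0] mult_left_mono[OF M[of "r1 n"], of "1 / Q"] Q by simp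
    then have "norm (w0 - y (r1 n)) \<le> sqrt (1 / Q * M)" by (rule real_le_rsqrt)
    then show ?thesis
      using norm_triangle_sub[of "y (r1 n)" w0] by (simp add: norm_minus_commute)
  qed
  then obtain ys r2 where r2: "strict_mono r2" "((y \<circ> r1) \<circ> r2) \<longlonglongrightarrow> ys"
    by (rule bounded_subseq_convergent[where X = "y \<circ> r1", OF cpt(2)])
  define r where "r = r1 \<circ> r2"
  have r: "strict_mono r" unfolding r_def using r1(1) r2(1) by (rule strict_mono_o)
  have x0: "(\<lambda>n. x (r n)) \<longlonglongrightarrow> xs"
    using LIMSEQ_subseq_LIMSEQ[OF r1(2) r2(1)] by (simp add: r_def o_def)
  have y0: "(\<lambda>n. y (r n)) \<longlonglongrightarrow> ys"
    using r2(2) by (simp add: r_def o_def)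
  have sub: "(\<lambda>n. s (r n)) \<longlonglongrightarrow> 0" if "s \<longlonglongrightarrow> 0" for s :: "nat \<Rightarrow> 'c::real_normed_vector"
    using LIMSEQ_subseq_LIMSEQ[OF that r] by (simp add: o_def)
  \<comment> \<open>Increments vanish, so shifted subsequences keep their limits. The optimality
    conditions are used at index \<open>Suc (r n)\<close>, where \<open>xp\<close> is simply
    \<open>x (r n)\<close>; they involve iterates up to \<open>Suc (Suc (r n))\<close>.\<close>
  have x1: "(\<lambda>n. x (Suc (r n))) \<longlonglongrightarrow> xs"
    using tendsto_add[OF x0 sub[OF dx]] by simp
  have x2: "(\<lambda>n. x (Suc (Suc (r n)))) \<longlonglongrightarrow> xs"
    using tendsto_add[OF x1 sub[OF LIMSEQ_Suc[OF dx]]] by simp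
  have y1: "(\<lambda>n. y (Suc (r n))) \<longlonglongrightarrow> ys"
    using tendsto_add[OF y0 sub[OF dy]] by simp
  have y2: "(\<lambda>n. y (Suc (Suc (r n)))) \<longlonglongrightarrow> ys"
    using tendsto_add[OF y1 sub[OF LIMSEQ_Suc[OF dy]]] by simp
  have e0: "(\<lambda>n. e (Suc (r n))) \<longlonglongrightarrow> 0"
    by (rule sub[OF LIMSEQ_Suc[OF tendsto_norm_zero_cancel[OF summable_LIMSEQ_zero[OF err(1)]]]])
  have \<epsilon>0: "(\<lambda>n. \<epsilon> (Suc (r n))) \<longlonglongrightarrow> 0"
    by (rule sub[OF LIMSEQ_Suc[OF summable_LIMSEQ_zero[OF err(2)]]])
  have \<delta>0: "(\<lambda>n. \<delta> (Suc (r n))) \<longlonglongrightarrow> 0"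
    by (rule sub[OF LIMSEQ_Suc[OF summable_LIMSEQ_zero[OF err(3)]]])
  have grad1: "(\<lambda>n. gradf (x (Suc (r n)))) \<longlonglongrightarrow> gradf xs"
  proof (rule tendsto_if_dist_square_le)
    show "(norm (gradf xs - gradf (x (Suc (r n)))))\<^sup>2 \<le> l\<^sup>2 * (norm (xs - x (Suc (r n))))\<^sup>2" for n
      using power_mono[OF gradf, of xs "x (Suc (r n))" 2] by (simp add: power_mult_distrib)
    have "(\<lambda>n. (norm (xs - x (Suc (r n))))\<^sup>2) \<longlonglongrightarrow> (norm (xs - xs))\<^sup>2"
      by (intro tendsto_intros x1)
    then show "(\<lambda>n. (norm (xs - x (Suc (r n))))\<^sup>2) \<longlonglongrightarrow> 0" by simp
  qed
  have k_le: "k ys \<le> ereal (Hw - K xs \<bullet> (w - ys))" if "k w = ereal Hw" for w Hw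
  proof (rule eps_subdiff_limit[OF k(2) y2 y_step \<delta>0 that])
    have "(\<lambda>n. (1 / \<sigma>) *\<^sub>R (y (Suc (r n)) + \<sigma> *\<^sub>R K (2 *\<^sub>R x (Suc (r n)) - xp (Suc (r n)))
          - y (Suc (Suc (r n)))) \<bullet> (w - y (Suc (Suc (r n)))))
        \<longlonglongrightarrow> (1 / \<sigma>) *\<^sub>R (ys + \<sigma> *\<^sub>R K (2 *\<^sub>R xs - xs) - ys) \<bullet> (w - ys)"
      unfolding xp by (intro tendsto_intros x0 x1 y1 y2 K.tendsto)
    then show "(\<lambda>n. (1 / \<sigma>) *\<^sub>R (y (Suc (r n)) + \<sigma> *\<^sub>R K (2 *\<^sub>R x (Suc (r n)) - xp (Suc (r n)))
          - y (Suc (Suc (r n)))) \<bullet> (w - y (Suc (Suc (r n))))) \<longlonglongrightarrow> K xs \<bullet> (w - ys)"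
      using pos by (simp add: scaleR_2)
  qed
  have g_le: "g xs \<le> ereal (Gu + K (u - xs) \<bullet> ys + gradf xs \<bullet> (u - xs))" if "g u = ereal Gu" for u Gu
  proof -
    \<comment> \<open>Moving the adjoint to the other factor leaves only \<open>K\<close>, and
      boundedness of \<open>K\<close> then yields the limit.\<close>
    have eq: "(1 / \<tau>) *\<^sub>R (p - \<tau> *\<^sub>R (K' q + d + e) - p1) \<bullet> (u - p1)
        = (1 / \<tau>) * ((p - p1) \<bullet> (u - p1)) - K (u - p1) \<bullet> q - (d + e) \<bullet> (u - p1)" for p p1 q d e
      using pos unfolding K' inner_commute[of "u - p1" "K' q"]
      by (simp add: inner_diff_left inner_add_left right_diff_distrib distrib_left)
    have "(\<lambda>n. (1 / \<tau>) * ((x (Suc (r n)) - x (Suc (Suc (r n)))) \<bullet> (u - x (Suc (Suc (r n)))))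
          - K (u - x (Suc (Suc (r n)))) \<bullet> y (Suc (Suc (r n)))
          - (gradf (x (Suc (r n))) + e (Suc (r n))) \<bullet> (u - x (Suc (Suc (r n)))))
        \<longlonglongrightarrow> (1 / \<tau>) * ((xs - xs) \<bullet> (u - xs)) - K (u - xs) \<bullet> ys - (gradf xs + 0) \<bullet> (u - xs)"
      by (intro tendsto_intros x1 x2 y2 e0 grad1 K.tendsto)
    then have lim: "(\<lambda>n. (1 / \<tau>) *\<^sub>R (x (Suc (r n)) - \<tau> *\<^sub>R (K' (y (Suc (Suc (r n)))) + gradf (x (Suc (r n)))
          + e (Suc (r n))) - x (Suc (Suc (r n)))) \<bullet> (u - x (Suc (Suc (r n)))))
        \<longlonglongrightarrow> - K (u - xs) \<bullet> ys - gradf xs \<bullet> (u - xs)"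
      unfolding eq by simp
    from eps_subdiff_limit[OF g(2) x2 x_step \<epsilon>0 that lim] show ?thesis
      by (simp add: algebra_simps)
  qed
  have saddle': "\<exists>G H. saddle_ineqs K F g k xs ys G H"
  proof -
    obtain u1 Gu1 where u1: "g u1 = ereal Gu1" using proper_finite_point[OF g(1)] .
    obtain w1 Hw1 where w1: "k w1 = ereal Hw1" using proper_finite_point[OF k(1)] .
    have "g xs < \<infinity>" using g_le[OF u1] by auto
    then obtain G where G: "g xs = ereal G" using proper_less_PInfty[OF g(1)] by blast
    have "k ys < \<infinity>" using k_le[OF w1] by auto
    then obtain H where H: "k ys = ereal H" using proper_less_PInfty[OF k(1)] by blast
    \<comment> \<open>The bound \<open>g_le\<close> is first-order optimality of \<open>xs\<close>;
      the gradient inequality for the convex \<open>F\<close> upgrades it to minimality.\<close>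
    have "K xs \<bullet> ys + F xs + G \<le> K u \<bullet> ys + F u + Gu" if "g u = ereal Gu" for u Gu
      using g_le[OF that] F_grad[of xs u] by (simp add: G K.diff inner_diff_left)
    moreover have "H + K xs \<bullet> (w - ys) \<le> Hw" if "k w = ereal Hw" for w Hw
      using k_le[OF that] by (simp add: H)
    ultimately have "saddle_ineqs K F g k xs ys G H"
      using G H unfolding saddle_ineqs_def by blast
    then show ?thesis by blast
  qed
  then obtain G H where S: "saddle_ineqs K F g k xs ys G H" by blast
  obtain v where v: "V xs ys \<longlonglongrightarrow> v" using Fejer(1)[OF S] by (auto simp: convergent_def)
  have "(\<lambda>n. V xs ys (Suc (r n))) \<longlonglongrightarrow> (norm (xs - xs))\<^sup>2 / (2 * \<tau>) + (norm (ys - ys))\<^sup>2 / (2 * \<sigma>)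
     + K (xs - xs) \<bullet> (ys - ys) + c / 2 * (norm (xs - xs))\<^sup>2"
    unfolding V_def energy_def xp using pos by (intro tendsto_intros x0 x1 y1 K.tendsto) auto
  then have "(\<lambda>n. V xs ys (Suc (r n))) \<longlonglongrightarrow> 0" by simp
  moreover have "(\<lambda>n. V xs ys (Suc (r n))) \<longlonglongrightarrow> v"
    using LIMSEQ_subseq_LIMSEQ[OF LIMSEQ_Suc[OF v] r] by (simp add: o_def)
  ultimately have "v = 0" using LIMSEQ_unique by blast
  with v have "V xs ys \<longlonglongrightarrow> 0" by simp
  then have "x \<longlonglongrightarrow> xs" "y \<longlonglongrightarrow> ys"
    using tendsto_if_dist_square_le[of xs x "2 * \<tau>"] tendsto_if_dist_square_le[of ys y "1 / Q"]
      V_ge_x V_ge_y by blast+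
  with saddle' show ?thesis by blast
qed

section \<open>Reduction of the three error types to the type-2 iteration\<close>

lemma summable_Suc_if_convergent_sum:
  fixes a :: "nat \<Rightarrow> real"
  assumes "convergent (\<lambda>N. \<Sum>n=1..N. a n)"
  shows "summable (\<lambda>n. a (Suc n))"
  using assms unfolding summable_iff_convergent by (simp add: sum.atLeast1_atMost_eq)

lemma summable_if_scaled_le:
  fixes s a :: "nat \<Rightarrow> real"
  assumes "c > 0" "summable a" "\<And>n. 0 \<le> s n" "\<And>n. c * s n \<le> a n"
  shows "summable s"
proof (rule summable_comparison_test)
  show "summable (\<lambda>n. 1 / c * a n)" by (intro summable_mult assms)
  show "\<exists>N. \<forall>n\<ge>N. norm (s n) \<le> 1 / c * a n"
    using assms(1,3,4) by (simp add: field_simps)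
qed

theorem theorem3p6:
  fixes K :: "'a::{real_inner, complete_space} \<Rightarrow> 'b::{real_inner, complete_space}"
    and f g :: "'a \<Rightarrow> ereal" and h :: "'b \<Rightarrow> ereal"
    and gradf :: "'a \<Rightarrow> 'a"
    and L\<^sub>f \<beta> \<tau> \<sigma> :: real
    and i :: nat
    and x e :: "nat \<Rightarrow> 'a" and y :: "nat \<Rightarrow> 'b"
    and \<epsilon> \<delta> :: "nat \<Rightarrow> real"
  assumes finite_dim_X: "\<exists>B :: 'a set. finite B \<and> span B = UNIV"
    and finite_dim_Y: "\<exists>B :: 'b set. finite B \<and> span B = UNIV"
    and K: "bounded_linear K"
    and f: "proper f" "econvex f" "lsc f"
    and gradf: "\<And>u. u \<in> edom f \<Longrightarrow> has_egradient f u (gradf u)"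
    and gradf_lipschitz: "\<And>u u'. u \<in> edom f \<Longrightarrow> u' \<in> edom f \<Longrightarrow>
           norm (gradf u - gradf u') \<le> L\<^sub>f * norm (u - u')"
    and g: "proper g" "econvex g" "lsc g"
    and h: "proper h" "econvex h" "lsc h"
    and saddle: "\<exists>xs ys. saddle_point (lagrangian K f g h) xs ys"
    and params: "\<beta> > 0" "\<tau> > 0" "\<sigma> > 0"
    and step: "\<tau> * L\<^sub>f + \<sigma> * \<tau> * (onorm K)\<^sup>2 + \<tau> * \<beta> * onorm K < 1"
    and i: "i \<in> {1, 2, 3}"
    and eps_nonneg: "\<And>n. n \<ge> 1 \<Longrightarrow> \<epsilon> n \<ge> 0"
    and delta_nonneg: "\<And>n. n \<ge> 1 \<Longrightarrow> \<delta> n \<ge> 0"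
    and y_step: "\<And>n. inexact_prox 2 (\<delta> (n + 1)) \<sigma> (conjugate h)
           (y n + \<sigma> *\<^sub>R K (2 *\<^sub>R x n - (if n = 0 then x 0 else x (n - 1)))) (y (n + 1))"
    and x_step: "\<And>n. inexact_prox i (\<epsilon> (n + 1)) \<tau> g
           (x n - \<tau> *\<^sub>R (adjoint K (y (n + 1)) + gradf (x n) + e (n + 1))) (x (n + 1))"
    and A_conv: "convergent (\<lambda>N. err_A i \<tau> e \<epsilon> N)"
    and B_conv: "convergent (\<lambda>N. err_B i \<tau> \<epsilon> \<delta> N)"
  shows "\<exists>xs ys. saddle_point (lagrangian K f g h) xs ys \<and> x \<longlonglongrightarrow> xs \<and> y \<longlonglongrightarrow> ys"
proof -
  have cpt: "compact (cball a r)" "compact (cball b r)" for a :: 'a and b :: 'b and r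
    by (intro finite_span_compact_cball finite_dim_X finite_dim_Y)+
  have adj: "K u \<bullet> w = u \<bullet> adjoint K w" for u w
    using K by (intro finite_span_adjoint finite_dim_X bounded_linear.linear)
  define F where "F u = real_of_ereal (f u)" for u
  have dom: "edom f = UNIV"
    by (rule edom_eq_UNIV[OF f gradf gradf_lipschitz])
  have F: "f u = ereal (F u)" for u
    using edom_eq_ereal[OF f(1)] by (simp add: dom F_def)
  have F_grad: "F u + gradf u \<bullet> (v - u) \<le> F v" for u v
    unfolding F_def by (intro econvex_gradient_le f gradf) (simp_all add: dom)
  have lip: "norm (gradf u - gradf v) \<le> L\<^sub>f * norm (u - v)" for u v
    using gradf_lipschitz by (simp add: dom)
  have "GDERIV F u :> gradf u" for u
    using gradf[of u] unfolding has_egradient_def F_def by (simp add: dom)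
  note F_descent = Lipschitz_gradient_descent[OF this lip]
  have k: "proper (conjugate h)" by (rule proper_conjugate[OF cpt(2) h])
  note saddle_iff = saddle_point_lagrangian_iff[of f F g h K, OF F g(1) k]
  obtain u0 w0 G0 H0 where sad: "saddle_ineqs K F g (conjugate h) u0 w0 G0 H0"
    using saddle unfolding saddle_iff by blast
  have "0 \<le> \<tau> * \<beta> * onorm K" using params onorm_pos_le[OF K] by simp
  with step have steps: "\<tau> * L\<^sub>f + \<sigma> * \<tau> * (onorm K)\<^sup>2 < 1" by linarith

  \<comment> \<open>\<open>\<rho>\<close> bounds the perturbation of the prox argument and
    \<open>\<epsilon>'\<close> is the subdifferential error that remains. The case distinctions
    match \<open>err_A\<close> and \<open>err_B\<close>, whose summands become
    \<open>\<tau> * norm (e n) + \<rho> n\<close> and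
    \<open>\<tau> * \<epsilon>' n + \<tau> * \<delta> n\<close>.\<close>
  define \<rho> where "\<rho> n = (if i = 2 then 0 else sqrt (2 * \<tau> * \<epsilon> n))" for n
  define \<epsilon>' where "\<epsilon>' n = (if i = 3 then 0 else \<epsilon> n)" for n
  have "\<exists>r. \<forall>n. norm (r n) \<le> \<rho> (n + 1) \<and>
      (1 / \<tau>) *\<^sub>R (x n - \<tau> *\<^sub>R (adjoint K (y (n + 1)) + gradf (x n) + e (n + 1)) + r n - x (n + 1))
        \<in> eps_subdiff (\<epsilon>' (n + 1)) g (x (n + 1))"
    unfolding \<rho>_def \<epsilon>'_def
    by (intro choice allI inexact_prox_eps_subdiff[OF cpt(1) g params(2) i x_step])
  then obtain r where r: "\<And>n. norm (r n) \<le> \<rho> (n + 1)"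
    "\<And>n. (1 / \<tau>) *\<^sub>R (x n - \<tau> *\<^sub>R (adjoint K (y (n + 1)) + gradf (x n) + e (n + 1)) + r n - x (n + 1))
        \<in> eps_subdiff (\<epsilon>' (n + 1)) g (x (n + 1))"
    by blast
  \<comment> \<open>Chosen so that \<open>- \<tau> *\<^sub>R e' n\<close> contains
    \<open>+ r n\<close>. The index drops by one, since \<open>e (n + 1)\<close> acts in the step
    from \<open>x n\<close> to \<open>x (n + 1)\<close>.\<close>
  define e' where "e' n = e (n + 1) - (1 / \<tau>) *\<^sub>R r n" for n
  have shift: "v - \<tau> *\<^sub>R (p + e (n + 1)) + r n = v - \<tau> *\<^sub>R (p + e' n)" for v p n
    using params by (simp add: e'_def algebra_simps)
  have x_step': "(1 / \<tau>) *\<^sub>R (x n - \<tau> *\<^sub>R (adjoint K (y (Suc n)) + gradf (x n) + e' n) - x (Suc n))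
      \<in> eps_subdiff (\<epsilon>' (Suc n)) g (x (Suc n))" for n
    using r(2)[of n] unfolding shift by simp
  define xp where "xp n = (if n = 0 then x 0 else x (n - 1))" for n
  have y_step': "(1 / \<sigma>) *\<^sub>R (y n + \<sigma> *\<^sub>R K (2 *\<^sub>R x n - xp n) - y (Suc n))
      \<in> eps_subdiff (\<delta> (Suc n)) (conjugate h) (y (Suc n))" for n
    using y_step[of n] unfolding inexact_prox_def xp_def by simp

  have "err_A i \<tau> e \<epsilon> N = (\<Sum>n=1..N. \<tau> * norm (e n) + \<rho> n)" for N
    by (simp add: err_A_def \<rho>_def)
  with A_conv have A: "summable (\<lambda>n. \<tau> * norm (e (Suc n)) + \<rho> (Suc n))"
    by (intro summable_Suc_if_convergent_sum) simp
  have "err_B i \<tau> \<epsilon> \<delta> N = (\<Sum>n=1..N. \<tau> * \<epsilon>' n + \<tau> * \<delta> n)" for N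
    by (simp add: err_B_def \<epsilon>'_def)
  with B_conv have B: "summable (\<lambda>n. \<tau> * \<epsilon>' (Suc n) + \<tau> * \<delta> (Suc n))"
    by (intro summable_Suc_if_convergent_sum) simp
  have nonneg: "\<epsilon>' (Suc n) \<ge> 0" "\<delta> (Suc n) \<ge> 0" for n
    using eps_nonneg delta_nonneg by (simp_all add: \<epsilon>'_def)
  have "\<tau> * norm (e' n) \<le> \<tau> * norm (e (Suc n)) + \<rho> (Suc n)" for n
  proof -
    have "norm (e' n) \<le> norm (e (Suc n)) + norm (r n) / \<tau>"
      using norm_triangle_ineq4[of "e (Suc n)" "(1 / \<tau>) *\<^sub>R r n"] params by (simp add: e'_def)
    then have "\<tau> * norm (e' n) \<le> \<tau> * norm (e (Suc n)) + norm (r n)"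
      using params by (simp add: field_simps)
    with r(1)[of n] show ?thesis by simp
  qed
  then have "summable (\<lambda>n. norm (e' n))"
    by (intro summable_if_scaled_le[OF params(2) A]) auto
  moreover have "summable (\<lambda>n. \<epsilon>' (Suc n))" "summable (\<lambda>n. \<delta> (Suc n))"
    by (rule summable_if_scaled_le[OF params(2) B]; use nonneg params in simp)+
  ultimately have "\<exists>xs ys. (\<exists>G H. saddle_ineqs K F g (conjugate h) xs ys G H) \<and> x \<longlonglongrightarrow> xs \<and> y \<longlonglongrightarrow> ys"
    by (intro primal_dual_convergence[where xp = xp and e = e' and \<epsilon> = "\<lambda>n. \<epsilon>' (Suc n)"
          and \<delta> = "\<lambda>n. \<delta> (Suc n)", OF cpt K adj F_grad F_descent lip g(1,3) k lsc_conjugate sad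
          params(2,3) steps nonneg _ _ _ _ _ y_step' x_step'])
      (simp_all add: xp_def)
  then show ?thesis unfolding saddle_iff .
qed

end
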